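(* Let $q$ be a prime power, let $m\ge 2$ be an integer, and let $k=\binom m2$. The higher weights of the Grassmann code $C(2,m)$ over $\mathbb{F}_q$ are always computed by Schubert unions. That is, for every $i\in\{1,\dots,k\}$ there exist a codimension $i$ linear subspace $\Lambda$ of the Plücker space $\mathbf{P}^{k-1}$ over $\mathbb{F}_q$ and a subset $U\subset I(2,m)$ such that $\Lambda\cap G(2,m)=S_U$ and the number of $\mathbb{F}_q$-rational points of $S_U$ equals $J_i$; equivalently, $d_i=n-\#S_U(\mathbb{F}_q)$.
   Context: Let $V$ be an $m$-dimensional vector space over $\mathbb{F}_q$ with a fixed basis $e_1,\dots,e_m$, and set $A_j=\mathrm{Span}\{e_1,\dots,e_j\}$. $G(2,m)$ is the Grassmann variety of $2$-dimensional subspaces of $V$, embedded by the Plücker embedding in $\mathbf{P}^{k-1}=\mathbf{P}(\wedge^2V)$, $k=\binom m2$. Its number of $\mathbb{F}_q$-rational points is $n=\frac{(q^m-1)(q^{m-1}-1)}{(q^2-1)(q-1)}$. Grassmann code: $C(2,m)$ is the linear code over $\mathbb{F}_q$ of length $n$ and dimension $k$ with a $k\times n$ generator matrix whose columns are coordinate representatives in $\mathbb{F}_q^k$ of the $n$ $\mathbb{F}_q$-rational points of $G(2,m)\subset\mathbf{P}^{k-1}$ (the choice of representatives and the ordering are irrelevant). For $1\le i\le k$, $d_i$ denotes the $i$-th higher weight (generalized Hamming weight) of $C(2,m)$, i.e. the minimal support size of an $i$-dimensional subcode. It is well known that $d_i=n-J_i$, where $J_i$ is the maximal number of $\mathbb{F}_q$-rational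 points of $G(2,m)$ lying on a codimension $i$ linear subspace of $\mathbf{P}^{k-1}$ defined over $\mathbb{F}_q$ (a codimension $k$ subspace being empty). Schubert unions: $I(2,m)=\{(a,b)\in\mathbb{Z}^2: 1\le a<b\le m\}$. For $\alpha=(a,b)\in I(2,m)$ the Schubert variety is $$S_\alpha=\{W\in G(2,m):\dim(W\cap A_a)\ge 1,\ \dim(W\cap A_b)\ge 2\}.$$ For $U\subset I(2,m)$ the Schubert union is $S_U=\bigcup_{\alpha\in U}S_\alpha$ (empty if $U=\emptyset$), all with respect to the one fixed flag $A_1\subset\cdots\subset A_m$. A higher weight $d_i$ is said to be computed by a Schubert union if some codimension $i$ linear subspace of the Plücker space intersects $G(2,m)$ in a Schubert union having exactly $J_i$ $\mathbb{F}_q$-rational points. *)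

theory Defs
  imports
    "HOL-Library.Function_Algebras"
    "HOL-Algebra.Algebraic_Closure_Type"
begin

text \<open>
  Vectors over a field are functions from an index type, with the pointwise addition of
  \<^theory>\<open>HOL-Library.Function_Algebras\<close>.  All spaces below lie in the span of finitely many
  unit vectors, so the dimension function of \<^locale>\<open>vector_space\<close> is the usual one.
\<close>

definition fun_scale :: "'a::field \<Rightarrow> ('i \<Rightarrow> 'a) \<Rightarrow> 'i \<Rightarrow> 'a" where
  "fun_scale c f = (\<lambda>i. c * f i)"

global_interpretation fs: vector_space "fun_scale :: 'a::field \<Rightarrow> ('i \<Rightarrow> 'a) \<Rightarrow> 'i \<Rightarrow> 'a"
  by standard (simp_all add: fun_scale_def fun_eq_iff algebra_simps)

definition unit_vec :: "'i \<Rightarrow> 'i \<Rightarrow> 'a::field" where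
  "unit_vec i = (\<lambda>j. if j = i then 1 else 0)"


section \<open>The Grassmann variety of 2-dimensional subspaces and its Schubert unions\<close>

text \<open>
  Every set of points is defined over an arbitrary field \<^typ>\<open>'a\<close>.  For varieties over a finite
  field \<^typ>\<open>'a\<close>, the instance at \<^typ>\<open>'a\<close> is the set of rational points, and the instance at
  \<^typ>\<open>'a alg_closure\<close> is the set of geometric points.  The ambient space is \<open>flag m\<close>.
\<close>

definition flag :: "nat \<Rightarrow> (nat \<Rightarrow> 'a::field) set" where
  "flag j = fs.span (unit_vec ` {1..j})"

definition grassmannian :: "nat \<Rightarrow> (nat \<Rightarrow> 'a::field) set set" where
  "grassmannian m = {W. fs.subspace W \<and> W \<subseteq> flag m \<and> fs.dim W = 2}"

definition I2 :: "nat \<Rightarrow> (nat \<times> nat) set" where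
  "I2 m = {(a, b). 1 \<le> a \<and> a < b \<and> b \<le> m}"

definition schubert_variety :: "nat \<Rightarrow> nat \<times> nat \<Rightarrow> (nat \<Rightarrow> 'a::field) set set" where
  "schubert_variety m = (\<lambda>(a, b).
     {W \<in> grassmannian m. fs.dim (W \<inter> flag a) \<ge> 1 \<and> fs.dim (W \<inter> flag b) \<ge> 2})"

definition schubert_union :: "nat \<Rightarrow> (nat \<times> nat) set \<Rightarrow> (nat \<Rightarrow> 'a::field) set set" where
  "schubert_union m U = (\<Union>\<alpha>\<in>U. schubert_variety m \<alpha>)"


section \<open>The Pluecker embedding\<close>

text \<open>
  The second exterior power of \<open>flag m\<close> in coordinates with respect to its basis of the vectors
  \<open>e\<^sub>a \<and> e\<^sub>b\<close>, \<open>(a, b) \<in> I2 m\<close>.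
\<close>

definition plucker_space :: "nat \<Rightarrow> (nat \<times> nat \<Rightarrow> 'a::field) set" where
  "plucker_space m = fs.span (unit_vec ` I2 m)"

definition wedge :: "nat \<Rightarrow> (nat \<Rightarrow> 'a::field) \<Rightarrow> (nat \<Rightarrow> 'a) \<Rightarrow> nat \<times> nat \<Rightarrow> 'a" where
  "wedge m u v = (\<lambda>(a, b). if (a, b) \<in> I2 m then u a * v b - u b * v a else 0)"

text \<open>
  A point of a projective space is a one-dimensional subspace.  A linear subspace of the projective
  space is given by a linear subspace \<open>L\<close> of the vector space below it, and \<open>proj_points L\<close> is
  its set of points, which is empty for \<open>L = {0}\<close>.
\<close>

definition proj_points :: "('i \<Rightarrow> 'a::field) set \<Rightarrow> ('i \<Rightarrow> 'a) set set" where
  "proj_points L = {P. fs.subspace P \<and> fs.dim P = 1 \<and> P \<subseteq> L}"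

definition plucker :: "nat \<Rightarrow> (nat \<Rightarrow> 'a::field) set \<Rightarrow> (nat \<times> nat \<Rightarrow> 'a) set" where
  "plucker m W = fs.span {wedge m u v | u v. u \<in> W \<and> v \<in> W}"

definition codim_subspace :: "nat \<Rightarrow> nat \<Rightarrow> (nat \<times> nat \<Rightarrow> 'a::field) set \<Rightarrow> bool" where
  "codim_subspace m i L \<longleftrightarrow>
     fs.subspace L \<and> L \<subseteq> plucker_space m \<and> fs.dim L + i = m choose 2"

definition base_change :: "('i \<Rightarrow> 'a::field) set \<Rightarrow> ('i \<Rightarrow> 'a alg_closure) set" where
  "base_change L = fs.span ((\<lambda>x. to_ac \<circ> x) ` L)"

definition max_section :: "'a::{field,finite} itself \<Rightarrow> nat \<Rightarrow> nat \<Rightarrow> nat" where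
  "max_section _ m i =
     Max {card (proj_points L \<inter> plucker m ` grassmannian m) | L :: (nat \<times> nat \<Rightarrow> 'a) set.
            codim_subspace m i L}"


section \<open>The Grassmann code and its higher weights\<close>

text \<open>
  A code of length \<open>n\<close> is a subspace of the functions \<^typ>\<open>nat \<Rightarrow> 'a\<close> that vanish outside
  \<open>{..<n}\<close>.  The \<open>i\<close>-th higher weight is the minimal support size of an \<open>i\<close>-dimensional subcode.
\<close>

definition code_support :: "(nat \<Rightarrow> 'a::field) set \<Rightarrow> nat set" where
  "code_support D = {j. \<exists>c\<in>D. c j \<noteq> 0}"

definition higher_weight :: "(nat \<Rightarrow> 'a::field) set \<Rightarrow> nat \<Rightarrow> nat" where
  "higher_weight C i =
     Min {card (code_support D) | D. fs.subspace D \<and> D \<subseteq> C \<and> fs.dim D = i}"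

definition grassmann_length :: "'a::{field,finite} itself \<Rightarrow> nat \<Rightarrow> nat" where
  "grassmann_length _ m = card (grassmannian m :: (nat \<Rightarrow> 'a) set set)"

text \<open>
  \<open>M j\<close> is the \<open>j\<close>-th column of a generator matrix whose rows are indexed by \<open>I2 m\<close>.  The columns
  represent the rational points of the Grassmann variety, each exactly once; their order and the
  representatives are arbitrary.
\<close>

definition grassmann_matrix :: "nat \<Rightarrow> (nat \<Rightarrow> nat \<times> nat \<Rightarrow> 'a::{field,finite}) \<Rightarrow> bool" where
  "grassmann_matrix m M \<longleftrightarrow>
     bij_betw (\<lambda>j. fs.span {M j}) {..<grassmann_length TYPE('a) m} (plucker m ` grassmannian m)"

definition grassmann_code ::
  "nat \<Rightarrow> (nat \<Rightarrow> nat \<times> nat \<Rightarrow> 'a::{field,finite}) \<Rightarrow> (nat \<Rightarrow> 'a) set" where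
  "grassmann_code m M =
     fs.span {\<lambda>j. if j < grassmann_length TYPE('a) m then M j \<beta> else 0 | \<beta>. \<beta> \<in> I2 m}"

end

theory Submission
  imports Defs "HOL-Library.Cardinality"
begin

text \<open>
  Up to constants, the number of points of a linear section is the number of pairs \<open>(u, v)\<close> of
  vectors with \<open>u \<and> v\<close> in a subspace \<open>L\<close> of the exterior square.  This number does not decrease
  under two operations that preserve \<open>dim L\<close>.  First, the torus limit of \<open>L\<close> that scales one basis
  vector; after all \<open>m\<close> limits \<open>L\<close> is spanned by the \<open>e\<^sub>a \<and> e\<^sub>b\<close> with \<open>(a, b)\<close> in the edge set of a
  graph.  Second, compression of the graph, which replaces edges \<open>jk\<close> by \<open>ik\<close> for fixed \<open>i < j\<close>.
  The compressed graphs are the down-sets of \<open>I(2, m)\<close>, and the section by the coordinate subspace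
  of a down-set is a Schubert union, over every field.  Annihilators carry this over to subcodes.
\<close>

section \<open>Coordinate subspaces\<close>

text \<open>Numbers of points over a finite field are not semicontinuous under limits for a formal
  reason, so every comparison is an explicit injection. The injections act on pairs
  \<open>(u, v)\<close> rather than on planes, because a pair can be altered one coordinate at a
  time. Passing between the two counts costs an additive constant, the pairs with
  \<open>u \<and> v = 0\<close>, and the factor |GL_2(q)|; neither depends on \<open>L\<close>.
  Scaling one basis vector gives only two weights on the exterior square, so the limit is the image
  of \<open>L\<close> under one projection plus the part of \<open>L\<close> in its kernel. The
  projections for different basis vectors commute, which is why a later limit does not undo an
  earlier one. Compression alters only the points at two vertices \<open>i\<close> and
  \<open>j\<close>. The remaining points confine each of them to a subspace of a plane, and the
  injection rests on the fact that two incomparable subspaces of a plane meet only in 0. Competing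
  subspaces are bounded by \<open>card L \<le> q^K\<close> instead of having a fixed dimension, so
  that for annihilators of subcodes an inequality suffices.\<close>

lemma fun_scale_apply: "fun_scale c f i = c * f i"
  by (simp add: fun_scale_def)

lemma sum_fun_apply: "(\<Sum>i\<in>I. f i) j = (\<Sum>i\<in>I. f i j :: 'a::comm_monoid_add)"
  by (induction I rule: infinite_finite_induct) simp_all

text \<open>For infinite \<open>I\<close> this is larger than the span of the unit vectors over
  \<open>I\<close>; hence the finiteness hypotheses below.\<close>

definition supported :: "'i set \<Rightarrow> ('i \<Rightarrow> 'a::field) set" where
  "supported I = {x. \<forall>i. i \<notin> I \<longrightarrow> x i = 0}"

lemma supportedI: "(\<And>i. i \<notin> I \<Longrightarrow> x i = 0) \<Longrightarrow> x \<in> supported I"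
  by (simp add: supported_def)

lemma supportedD: "x \<in> supported I \<Longrightarrow> i \<notin> I \<Longrightarrow> x i = 0"
  by (simp add: supported_def)

lemma subspace_supported [simp]: "fs.subspace (supported I)"
  by (auto simp: fs.subspace_def fun_scale_apply supported_def)

lemma unit_vec_in_supported [simp]: "unit_vec i \<in> (supported I :: ('i \<Rightarrow> 'a::field) set) \<longleftrightarrow> i \<in> I"
  by (auto simp: supported_def unit_vec_def)

lemma inj_unit_vec: "inj (unit_vec :: 'i \<Rightarrow> 'i \<Rightarrow> 'a::field)"
  by (rule injI) (metis unit_vec_def zero_neq_one)

lemma supported_eq_sum:
  assumes "finite I" "x \<in> supported I"
  shows "x = (\<Sum>i\<in>I. fun_scale (x i) (unit_vec i))"
proof
  fix j
  have "(\<Sum>i\<in>I. fun_scale (x i) (unit_vec i)) j = (\<Sum>i\<in>I. if i = j then x j else 0)"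
    unfolding sum_fun_apply by (rule sum.cong) (auto simp: unit_vec_def fun_scale_apply)
  then show "x j = (\<Sum>i\<in>I. fun_scale (x i) (unit_vec i)) j"
    using assms by (simp add: supported_def)
qed

lemma span_unit_vec:
  assumes "finite I"
  shows "fs.span (unit_vec ` I) = (supported I :: ('i \<Rightarrow> 'a::field) set)"
proof
  show "fs.span (unit_vec ` I) \<subseteq> (supported I :: ('i \<Rightarrow> 'a::field) set)"
    by (rule fs.span_minimal) auto
  show "(supported I :: ('i \<Rightarrow> 'a::field) set) \<subseteq> fs.span (unit_vec ` I)"
  proof
    fix x :: "'i \<Rightarrow> 'a" assume "x \<in> supported I"
    then have "x = (\<Sum>i\<in>I. fun_scale (x i) (unit_vec i))"
      by (rule supported_eq_sum[OF assms])
    moreover have "(\<Sum>i\<in>I. fun_scale (x i) (unit_vec i)) \<in> fs.span (unit_vec ` I)"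
      by (intro fs.span_sum fs.span_scale fs.span_base) auto
    ultimately show "x \<in> fs.span (unit_vec ` I)" by simp
  qed
qed

lemma independent_unit_vec: "fs.independent (unit_vec ` I :: ('i \<Rightarrow> 'a::field) set)"
proof (unfold fs.dependent_explicit, safe)
  fix t u v
  assume t: "finite t" "t \<subseteq> (unit_vec ` I :: ('i \<Rightarrow> 'a) set)" "v \<in> t" "u v \<noteq> 0"
    and s: "(\<Sum>v\<in>t. fun_scale (u v) v) = 0"
  obtain i where i: "v = unit_vec i" using t by auto
  have "0 = (\<Sum>w\<in>t. u w * w i)"
    using arg_cong[OF s, of "\<lambda>f. f i"] by (simp add: sum_fun_apply fun_scale_apply)
  also have "\<dots> = (\<Sum>w\<in>t. if w = v then u v else 0)"
  proof (rule sum.cong[OF refl])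
    fix w assume "w \<in> t"
    then obtain j where "w = unit_vec j" using t by auto
    moreover have "unit_vec j \<noteq> (unit_vec i :: 'i \<Rightarrow> 'a)" if "j \<noteq> i" for j
      using that by (metis unit_vec_def zero_neq_one)
    ultimately show "u w * w i = (if w = v then u v else 0)"
      using i by (cases "j = i") (simp_all, simp_all add: unit_vec_def)
  qed
  also have "\<dots> = u v" using t by simp
  finally show False using t by simp
qed

lemma card_unit_vec_image: "card (unit_vec ` I :: ('i \<Rightarrow> 'a::field) set) = card I"
  by (rule card_image) (rule inj_on_subset[OF inj_unit_vec], simp)

lemma dim_supported:
  assumes "finite I"
  shows "fs.dim (supported I :: ('i \<Rightarrow> 'a::field) set) = card I"
  using fs.dim_span_eq_card_independent[OF independent_unit_vec, where 'a='a, of I]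
  by (simp add: span_unit_vec[OF assms] card_unit_vec_image)

text \<open>The ambient function space may be infinite-dimensional; the exchange bound against the
  unit vectors over \<open>I\<close> is what makes the basis finite.\<close>

lemma supported_basis:
  assumes "finite I" "L \<subseteq> (supported I :: ('i \<Rightarrow> 'a::field) set)"
  obtains B where "B \<subseteq> L" "fs.independent B" "L \<subseteq> fs.span B" "finite B" "card B = fs.dim L"
proof -
  obtain B where B: "B \<subseteq> L" "fs.independent B" "L \<subseteq> fs.span B" "card B = fs.dim L"
    by (rule fs.basis_exists)
  have "B \<subseteq> fs.span (unit_vec ` I)" using B assms span_unit_vec by blast
  then have "finite B"
    using fs.independent_span_bound[of "unit_vec ` I" B] B(2) assms(1) by auto
  with B that show ?thesis by blast
qed

section \<open>Cardinalities of subspaces over a finite field\<close>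

lemma finite_supported:
  assumes "finite I"
  shows "finite (supported I :: ('i \<Rightarrow> 'a::{field,finite}) set)"
proof -
  have "finite {f. \<forall>x. (x \<in> I \<longrightarrow> f x \<in> (UNIV::'a set)) \<and> (x \<notin> I \<longrightarrow> f x = (0::'a))}"
    by (rule finite_set_of_finite_funs) (use assms in auto)
  then show ?thesis by (simp add: supported_def)
qed

lemma card_field_gt_1: "CARD('a::{field,finite}) > 1"
proof -
  have "card {0, 1 :: 'a} \<le> CARD('a)" by (rule card_mono) simp_all
  then show ?thesis by simp
qed

text \<open>Adjoining \<open>b\<close> multiplies the size by \<open>q\<close>: the expression
  \<open>c b + x\<close> with \<open>x\<close> in the old span is unique.\<close>

lemma card_span_independent:
  fixes B :: "('i \<Rightarrow> 'a::{field,finite}) set"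
  assumes "finite B" "fs.independent B"
  shows "card (fs.span B) = CARD('a) ^ card B"
  using assms
proof (induction B)
  case (insert b B)
  have nb: "b \<notin> fs.span B" and indep: "fs.independent B"
    using insert.prems insert.hyps fs.independent_insert[of b B] by presburger+
  let ?f = "\<lambda>(c, x). fun_scale c b + x"
  have "bij_betw ?f (UNIV \<times> fs.span B) (fs.span (insert b B))"
  proof (rule bij_betwI')
    fix p q :: "'a \<times> ('i \<Rightarrow> 'a)" assume "p \<in> UNIV \<times> fs.span B" "q \<in> UNIV \<times> fs.span B"
    moreover have "c = d \<and> x = y"
      if xy: "x \<in> fs.span B" "y \<in> fs.span B" and e: "fun_scale c b + x = fun_scale d b + y" for c d x y
    proof -
      have "fun_scale (c - d) b = y - x" using e by (simp add: fs.scale_left_diff_distrib algebra_simps)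
      then have *: "fun_scale (c - d) b \<in> fs.span B" using xy by (simp add: fs.span_diff)
      have "c = d"
      proof (rule ccontr)
        assume "c \<noteq> d"
        then have "b = fun_scale (inverse (c - d)) (fun_scale (c - d) b)" by simp
        then show False using nb fs.span_scale[OF *] by metis
      qed
      then show ?thesis using e by simp
    qed
    ultimately show "(?f p = ?f q) = (p = q)"
      unfolding case_prod_beta prod_eq_iff mem_Times_iff by metis
  next
    fix p :: "'a \<times> ('i \<Rightarrow> 'a)" assume "p \<in> UNIV \<times> fs.span B"
    then have "snd p \<in> fs.span (insert b B)"
      using fs.span_mono[OF subset_insertI[of B b]] by auto
    moreover have "fun_scale (fst p) b \<in> fs.span (insert b B)"
      by (intro fs.span_scale fs.span_base insertI1)
    ultimately show "?f p \<in> fs.span (insert b B)"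
      unfolding case_prod_beta by (rule_tac fs.span_add)
  next
    fix y assume "y \<in> fs.span (insert b B)"
    then obtain k where "y - fun_scale k b \<in> fs.span B" by (auto simp: fs.span_breakdown_eq)
    then show "\<exists>p\<in>UNIV \<times> fs.span B. y = ?f p"
      by (intro bexI[of _ "(k, y - fun_scale k b)"]) auto
  qed
  then have "card (fs.span (insert b B)) = card ((UNIV :: 'a set) \<times> fs.span B)"
    by (rule bij_betw_same_card[symmetric])
  then show ?case using insert indep by (simp add: card_cartesian_product)
qed simp

lemma card_subspace:
  fixes L :: "('i \<Rightarrow> 'a::{field,finite}) set"
  assumes "finite I" "L \<subseteq> supported I" "fs.subspace L"
  shows "card L = CARD('a) ^ fs.dim L"
proof -
  obtain B where B: "B \<subseteq> L" "fs.independent B" "L \<subseteq> fs.span B" "finite B" "card B = fs.dim L"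
    by (rule supported_basis[OF assms(1,2)])
  then have "fs.span B = L" using assms(3) fs.span_subspace by blast
  then show ?thesis using card_span_independent B by metis
qed

text \<open>A basis of \<open>L\<close> extends by unit vectors \<open>unit_vec i\<close>, \<open>i \<in> J\<close>, and a functional that vanishes
  on \<open>L\<close> is determined by its coordinates in \<open>J\<close>.\<close>

lemma card_orthogonal_le:
  fixes L \<Phi> :: "('i \<Rightarrow> 'a::{field,finite}) set"
  assumes I: "finite I" and L: "L \<subseteq> supported I" "fs.subspace L"
    and P: "\<Phi> \<subseteq> supported I" "fs.subspace \<Phi>"
    and orth: "\<And>x \<phi>. x \<in> L \<Longrightarrow> \<phi> \<in> \<Phi> \<Longrightarrow> (\<Sum>i\<in>I. \<phi> i * x i) = 0"
  shows "card L * card \<Phi> \<le> CARD('a) ^ card I"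
proof -
  obtain B where B: "B \<subseteq> L" "fs.independent B" "L \<subseteq> fs.span B" "finite B" "card B = fs.dim L"
    by (rule supported_basis[OF I L(1)])
  obtain B' where B': "B \<subseteq> B'" "B' \<subseteq> B \<union> unit_vec ` I" "fs.independent B'"
    "B \<union> unit_vec ` I \<subseteq> fs.span B'"
    by (rule fs.maximal_independent_subset_extend[of B "B \<union> unit_vec ` I"]) (use B in auto)
  have spanB': "fs.span B' = supported I"
  proof
    have "unit_vec ` I \<subseteq> (supported I :: ('i \<Rightarrow> 'a) set)" by auto
    then have "B' \<subseteq> supported I" using B'(2) B(1) L(1) by blast
    then show "fs.span B' \<subseteq> supported I" by (rule fs.span_minimal) simp
    have "fs.span (unit_vec ` I) \<subseteq> fs.span B'" using B' by (intro fs.span_minimal) auto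
    then show "supported I \<subseteq> fs.span B'" by (simp add: span_unit_vec[OF I])
  qed
  have finB': "finite B'" using B' B I finite_subset[of B' "B \<union> unit_vec ` I"] by simp
  have cB': "card B' = card I"
    using fs.dim_span_eq_card_independent[OF B'(3)] by (simp add: spanB' dim_supported[OF I])
  define J where "J = {i \<in> I. unit_vec i \<in> B' - B}"
  have "unit_vec ` J = B' - B" unfolding J_def using B' by auto
  then have cJ: "card B + card J = card I"
    using cB' card_unit_vec_image[of J, where 'a='a] card_Diff_subset[OF B(4) B'(1)]
      card_mono[OF finB' B'(1)] by simp
  have "card \<Phi> \<le> card (supported J :: ('i \<Rightarrow> 'a) set)"
  proof (rule card_inj_on_le)
    show "(\<lambda>\<phi> i. if i \<in> J then \<phi> i else 0) ` \<Phi> \<subseteq> supported J" by (auto simp: supported_def)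
    show "finite (supported J :: ('i \<Rightarrow> 'a) set)" by (rule finite_supported) (simp add: J_def I)
    show "inj_on (\<lambda>\<phi> i. if i \<in> J then \<phi> i else 0) \<Phi>"
    proof (rule inj_onI)
      fix \<phi> \<phi>' assume pp: "\<phi> \<in> \<Phi>" "\<phi>' \<in> \<Phi>"
        and e: "(\<lambda>i. if i \<in> J then \<phi> i else 0) = (\<lambda>i. if i \<in> J then \<phi>' i else 0)"
      define \<psi> where "\<psi> = \<phi> - \<phi>'"
      have psi: "\<psi> \<in> \<Phi>" unfolding \<psi>_def using pp P(2) by (rule_tac fs.subspace_diff)
      have psiJ: "\<psi> i = 0" if "i \<in> J" for i using fun_cong[OF e, of i] that by (simp add: \<psi>_def)
      \<comment> \<open>The zero set of \<open>\<psi>\<close> contains \<open>B\<close> by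
        orthogonality and the rest of \<open>B'\<close> by the choice of \<open>J\<close>, hence all
        of \<open>supported I\<close>; evaluation at unit vectors then gives
        \<open>\<psi> = 0\<close>.\<close>
      define S where "S = {x. (\<Sum>i\<in>I. \<psi> i * x i) = 0}"
      have subS: "fs.subspace S"
        by (auto simp: S_def fs.subspace_def fun_scale_apply distrib_left sum.distrib mult.left_commute simp flip: sum_distrib_left)
      have "unit_vec i \<in> S \<longleftrightarrow> \<psi> i = 0" if "i \<in> I" for i
        proof -
        have "(\<Sum>j\<in>I. \<psi> j * unit_vec i j) = (\<Sum>j\<in>I. if j = i then \<psi> i else 0)"
          by (rule sum.cong) (auto simp: unit_vec_def)
        then show ?thesis using that I by (simp add: S_def)
      qed
      note unitS = this
      have "B' \<subseteq> S"
      proof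
        fix b assume b: "b \<in> B'"
        show "b \<in> S"
        proof (cases "b \<in> B")
          case True
          then show ?thesis using orth[OF _ psi] B by (auto simp: S_def)
        next
          case False
          then obtain i where "i \<in> J" "b = unit_vec i" using b \<open>unit_vec ` J = B' - B\<close> by auto
          then show ?thesis using unitS psiJ by (auto simp: J_def)
        qed
      qed
      then have "fs.span B' \<subseteq> S" by (rule fs.span_minimal[OF _ subS])
      then have "\<psi> i = 0" if "i \<in> I" for i using that spanB' unitS[OF that] by auto
      moreover have "\<psi> i = 0" if "i \<notin> I" for i using that psi P(1) by (auto simp: supported_def)
      ultimately have "\<psi> i = 0" for i by blast
      then show "\<phi> = \<phi>'" by (auto simp: \<psi>_def fun_eq_iff)
    qed
  qed
  also have "\<dots> = CARD('a) ^ card J"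
    using card_subspace[of J "supported J :: ('i \<Rightarrow> 'a) set"] I by (simp add: J_def dim_supported)
  finally have "card L * card \<Phi> \<le> CARD('a) ^ card B * CARD('a) ^ card J"
    using card_subspace[OF I L] B(5) by simp
  then show ?thesis by (simp add: cJ flip: power_add)
qed

section \<open>Pluecker coordinates and Schubert unions\<close>

lemma flag_eq_supported: "flag j = (supported {1..j} :: (nat \<Rightarrow> 'a::field) set)"
  by (simp add: flag_def span_unit_vec)

lemma subspace_flag [simp]: "fs.subspace (flag m)"
  by (simp add: flag_eq_supported)

lemma I2_Suc: "I2 (Suc m) = I2 m \<union> (\<lambda>a. (a, Suc m)) ` {1..m}"
  by (auto simp: I2_def)

lemma finite_I2 [simp]: "finite (I2 m)"
proof (rule finite_subset)
  show "I2 m \<subseteq> {..m} \<times> {..m}" by (auto simp: I2_def)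
qed (rule finite_cartesian_product; simp)

lemma card_I2: "card (I2 m) = m choose 2"
proof (induction m)
  case 0
  have "I2 0 = {}" by (auto simp: I2_def)
  then show ?case by simp
next
  case (Suc m)
  have "I2 m \<inter> (\<lambda>a. (a, Suc m)) ` {1..m} = {}" by (auto simp: I2_def)
  then have "card (I2 (Suc m)) = card (I2 m) + card ((\<lambda>a. (a, Suc m)) ` {1..m})"
    unfolding I2_Suc by (intro card_Un_disjoint) simp_all
  then show ?case using Suc by (simp add: card_image inj_on_def numeral_2_eq_2)
qed

lemma plucker_space_eq_supported: "plucker_space m = (supported (I2 m) :: (nat \<times> nat \<Rightarrow> 'a::field) set)"
  by (simp add: plucker_space_def span_unit_vec)

lemma codim_supported:
  assumes "U \<subseteq> I2 m" "card U + i = m choose 2"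
  shows "codim_subspace m i (supported U :: (nat \<times> nat \<Rightarrow> 'a::field) set)"
proof -
  have "finite U" using assms finite_subset finite_I2 by blast
  moreover have "(supported U :: (nat \<times> nat \<Rightarrow> 'a) set) \<subseteq> supported (I2 m)"
    using assms by (auto simp: supported_def)
  ultimately show ?thesis
    using assms by (simp add: codim_subspace_def plucker_space_eq_supported dim_supported)
qed

text \<open>Coordinate subspaces are spanned by vectors with entries 0 and 1, which
  \<open>to_ac\<close> preserves. Statements about them over an arbitrary field therefore apply to
  geometric points as well.\<close>

lemma base_change_supported:
  assumes "finite U"
  shows "base_change (supported U :: ('i \<Rightarrow> 'a::field) set) = supported U"
proof
  show "base_change (supported U :: ('i \<Rightarrow> 'a) set) \<subseteq> supported U"
    unfolding base_change_def
    by (rule fs.span_minimal[OF _ subspace_supported]) (auto simp: supported_def)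
  have ac: "unit_vec i = to_ac \<circ> (unit_vec i :: 'i \<Rightarrow> 'a)" for i :: 'i
    by (auto simp: unit_vec_def)
  have "unit_vec ` U \<subseteq> (\<lambda>x. to_ac \<circ> x) ` (supported U :: ('i \<Rightarrow> 'a) set)"
    by (rule image_subsetI, rule image_eqI, rule ac) simp
  then have "fs.span (unit_vec ` U) \<subseteq> base_change (supported U :: ('i \<Rightarrow> 'a) set)"
    unfolding base_change_def by (rule fs.span_mono)
  then show "supported U \<subseteq> base_change (supported U :: ('i \<Rightarrow> 'a) set)"
    by (simp add: span_unit_vec[OF assms])
qed

section \<open>Decomposable vectors and points of the Grassmannian\<close>

lemma mem_span_pair: "x \<in> fs.span {u, v} \<longleftrightarrow> (\<exists>\<alpha> \<beta>. x = fun_scale \<alpha> u + fun_scale \<beta> v)"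
proof -
  have "x \<in> fs.span {u, v} \<longleftrightarrow> (\<exists>\<alpha> \<beta>. x - fun_scale \<alpha> u = fun_scale \<beta> v)"
    unfolding fs.span_insert[of u "{v}"] fs.span_singleton by blast
  moreover have "x - p = r \<longleftrightarrow> x = p + r" for p r
    unfolding diff_eq_eq add.commute[of r p] ..
  ultimately show ?thesis by (simp only:)
qed

lemma wedge_eq_0_iff:
  "wedge m u v = 0 \<longleftrightarrow> (\<forall>a\<in>{1..m}. \<forall>b\<in>{1..m}. u a * v b = u b * v a)"
proof
  assume *: "wedge m u v = 0"
  have "u a * v b = u b * v a" if "a \<in> {1..m}" "b \<in> {1..m}" "a < b" for a b
    using that fun_cong[OF *, of "(a, b)"] by (auto simp: wedge_def I2_def)
  then show "\<forall>a\<in>{1..m}. \<forall>b\<in>{1..m}. u a * v b = u b * v a"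
    by (metis linorder_neqE_nat mult.commute)
qed (auto simp: wedge_def I2_def fun_eq_iff)

lemma wedge_comb:
  "wedge m (fun_scale \<alpha> u + fun_scale \<beta> v) (fun_scale \<gamma> u + fun_scale \<delta> v)
     = fun_scale (\<alpha> * \<delta> - \<beta> * \<gamma>) (wedge m u v)"
  by (auto simp: wedge_def fun_eq_iff fun_scale_apply algebra_simps)

lemma wedge_in_plucker_space [simp]: "wedge m u v \<in> supported (I2 m)"
  by (auto simp: wedge_def supported_def)

lemma independent_singleton: "fs.independent {x} \<longleftrightarrow> x \<noteq> 0"
  using fs.independent_insert[of x "{}"]
  unfolding fs.span_empty by (simp only: fs.independent_empty empty_iff if_False singleton_iff simp_thms)

lemma independent_pair: "u \<noteq> v \<and> fs.independent {u, v} \<longleftrightarrow> u \<notin> fs.span {v} \<and> v \<noteq> 0"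
proof -
  have "v \<in> fs.span {v}" by (rule fs.span_base) (rule singletonI)
  then show ?thesis
    using fs.independent_insert[of u "{v}"] unfolding independent_singleton singleton_iff by metis
qed

lemma independent_pair_iff_wedge:
  assumes "u \<in> flag m" "v \<in> flag m"
  shows "u \<noteq> v \<and> fs.independent {u, v} \<longleftrightarrow> wedge m u v \<noteq> 0"
proof
  assume *: "u \<noteq> v \<and> fs.independent {u, v}"
  then have ind: "v \<noteq> 0" "u \<notin> fs.span {v}"
    unfolding independent_pair by blast+
  show "wedge m u v \<noteq> 0"
  proof
    assume 0: "wedge m u v = 0"
    \<comment> \<open>The minors that involve the nonzero entry \<open>v b\<close> force
      \<open>u\<close> to be a multiple of \<open>v\<close>.\<close>
    obtain b where b: "v b \<noteq> 0" using ind(1) by (auto simp: fun_eq_iff)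
    have bm: "b \<in> {1..m}" using b assms by (auto simp: flag_eq_supported supported_def)
    have "u a = u b / v b * v a" for a
    proof (cases "a \<in> {1..m}")
      case True
      then have "u a * v b = u b * v a" using 0 bm unfolding wedge_eq_0_iff by blast
      then show ?thesis using b by (simp add: field_simps)
    next
      case False
      then show ?thesis using assms by (auto simp: flag_eq_supported supported_def)
    qed
    then have "u = fun_scale (u b / v b) v" unfolding fun_eq_iff fun_scale_apply by blast
    then show False using ind fs.span_singleton by blast
  qed
next
  assume w: "wedge m u v \<noteq> 0"
  have "u \<notin> fs.span {v}"
  proof
    assume "u \<in> fs.span {v}"
    then obtain k where "u = fun_scale k v" by (auto simp: fs.span_singleton)
    then have "wedge m u v = 0" by (auto simp: wedge_eq_0_iff fun_scale_apply)
    with w show False by simp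
  qed
  moreover have "v \<noteq> 0" using w by (auto simp: wedge_eq_0_iff)
  ultimately show "u \<noteq> v \<and> fs.independent {u, v}"
    unfolding independent_pair by blast
qed

lemma grassmannianE:
  assumes "W \<in> grassmannian m"
  obtains u v where "u \<in> flag m" "v \<in> flag m" "W = fs.span {u, v}" "wedge m u v \<noteq> 0"
proof -
  have W: "fs.subspace W" "W \<subseteq> flag m" "fs.dim W = 2" using assms by (auto simp: grassmannian_def)
  obtain B where B: "B \<subseteq> W" "fs.independent B" "W \<subseteq> fs.span B" "finite B" "card B = 2"
    using supported_basis[of "{1..m}" W] W by (auto simp: flag_eq_supported)
  obtain u v where uv: "B = {u, v}" "u \<noteq> v" using B(5) by (auto simp: card_2_iff)
  have "W = fs.span B" using B W fs.span_subspace by blast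
  then show ?thesis using that[of u v] uv B W independent_pair_iff_wedge[of u m v] by auto
qed

lemma span_pair_in_grassmannian:
  assumes "u \<in> flag m" "v \<in> flag m" "wedge m u v \<noteq> 0"
  shows "fs.span {u, v} \<in> grassmannian m"
proof -
  have ne: "u \<noteq> v" and ind: "fs.independent {u, v}"
    using independent_pair_iff_wedge[OF assms(1,2)] assms(3) by auto
  have "fs.dim (fs.span {u, v}) = 2"
    using fs.dim_span_eq_card_independent[OF ind] ne by simp
  moreover have "fs.span {u, v} \<subseteq> flag m"
    by (rule fs.span_minimal) (use assms in auto)
  ultimately show ?thesis by (simp add: grassmannian_def)
qed

lemma plucker_span: "plucker m (fs.span {u, v}) = fs.span {wedge m u v}"
proof
  show "plucker m (fs.span {u, v}) \<subseteq> fs.span {wedge m u v}"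
    unfolding plucker_def
  proof (rule fs.span_minimal, safe)
    fix x y assume "x \<in> fs.span {u, v}" "y \<in> fs.span {u, v}"
    then obtain \<alpha> \<beta> \<gamma> \<delta> where "x = fun_scale \<alpha> u + fun_scale \<beta> v" "y = fun_scale \<gamma> u + fun_scale \<delta> v"
      unfolding mem_span_pair by blast
    then show "wedge m x y \<in> fs.span {wedge m u v}"
      by (simp add: wedge_comb fs.span_scale fs.span_base)
  qed
  have "u \<in> fs.span {u, v}" "v \<in> fs.span {u, v}" by (simp_all add: fs.span_base)
  then show "fs.span {wedge m u v} \<subseteq> plucker m (fs.span {u, v})"
    unfolding plucker_def by (intro fs.span_mono) auto
qed

lemma span_singleton_subset_iff:
  assumes "fs.subspace L"
  shows "fs.span {x} \<subseteq> L \<longleftrightarrow> x \<in> L"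
  using fs.span_minimal[of "{x}" L] fs.span_base[of x "{x}"] assms by blast

lemma plucker_subset_iff:
  assumes "fs.subspace L"
  shows "plucker m (fs.span {u, v}) \<subseteq> L \<longleftrightarrow> wedge m u v \<in> L"
  by (simp add: plucker_span span_singleton_subset_iff assms)

lemma proj_points_section:
  "proj_points L \<inter> plucker m ` grassmannian m = plucker m ` {W \<in> grassmannian m. plucker m W \<subseteq> L}"
proof -
  have "plucker m W \<in> proj_points L \<longleftrightarrow> plucker m W \<subseteq> L"
    if W: "W \<in> (grassmannian m :: (nat \<Rightarrow> 'a) set set)" for W
  proof -
    obtain u v where uv: "W = fs.span {u, v}" "wedge m u v \<noteq> 0"
      using W by (rule grassmannianE)
    have ind: "fs.independent {wedge m u v}"
      unfolding independent_singleton by (rule uv)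
    then have "fs.dim (plucker m W) = 1"
      unfolding uv(1) plucker_span using fs.dim_span_eq_card_independent[OF ind] by simp
    then show ?thesis using uv by (simp add: proj_points_def plucker_span)
  qed
  then show ?thesis by blast
qed

text \<open>\<open>W\<close> is spanned by the contractions of its Pluecker vector with the coordinate functionals.\<close>

lemma inj_on_plucker: "inj_on (plucker m) (grassmannian m :: (nat \<Rightarrow> 'a::field) set set)"
proof -
  \<comment> \<open>A Pluecker vector stores only the positions \<open>(a, l)\<close> with
    \<open>a < l\<close>; \<open>ext\<close> restores antisymmetry, so that it is contraction in the
    first slot.\<close>
  define ext :: "(nat \<times> nat \<Rightarrow> 'a) \<Rightarrow> nat \<Rightarrow> nat \<Rightarrow> 'a"
    where "ext = (\<lambda>x a l. if a < l then x (a, l) else - x (l, a))"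
  define R where "R = (\<lambda>P. fs.span {ext x a | x a. x \<in> P \<and> a \<in> {1..m}})"
  have "R (plucker m W) = W" if W: "W \<in> grassmannian m" for W
  proof -
    obtain u v where uv: "u \<in> flag m" "v \<in> flag m" "W = fs.span {u, v}" "wedge m u v \<noteq> 0"
      using W by (rule grassmannianE)
    have sW: "fs.subspace W" using uv by simp
    have uW: "u \<in> W" "v \<in> W" using uv by (auto intro: fs.span_base)
    have ext_wedge: "ext (wedge m u v) a = fun_scale (u a) v - fun_scale (v a) u" if "a \<in> {1..m}" for a
    proof
      fix l
      have "u l = 0 \<and> v l = 0" if "l \<notin> {1..m}"
        using that uv by (auto simp: flag_eq_supported supported_def)
      then show "ext (wedge m u v) a l = (fun_scale (u a) v - fun_scale (v a) u) l"
        using that by (cases "l \<in> {1..m}") (auto simp: ext_def wedge_def I2_def fun_scale_apply)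
    qed
    have ext_scale: "ext (fun_scale c x) a = fun_scale c (ext x a)" for c x a
      by (auto simp: ext_def fun_scale_apply)
    have pW: "plucker m W = fs.span {wedge m u v}" using uv plucker_span by simp
    show ?thesis
    proof
      have "ext x a \<in> W" if "x \<in> plucker m W" "a \<in> {1..m}" for x a
      proof -
        obtain k where k: "x = fun_scale k (wedge m u v)"
          using \<open>x \<in> plucker m W\<close> pW by (auto simp: fs.span_singleton)
        show ?thesis
          unfolding k ext_scale ext_wedge[OF that(2)]
          by (intro fs.subspace_scale fs.subspace_diff sW uW)
      qed
      then show "R (plucker m W) \<subseteq> W"
        unfolding R_def by (intro fs.span_minimal sW) auto
      obtain a b where ab: "a \<in> {1..m}" "b \<in> {1..m}" "u a * v b \<noteq> u b * v a"
        using uv(4) by (auto simp: wedge_eq_0_iff)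
      \<comment> \<open>Cramer's rule: the nonzero minor at \<open>(a, b)\<close> recovers
        \<open>u\<close> and \<open>v\<close> from the contractions at \<open>a\<close> and
        \<open>b\<close>.\<close>
      define D where "D = u a * v b - u b * v a"
      have D: "D \<noteq> 0" using ab by (simp add: D_def)
      have wp: "wedge m u v \<in> plucker m W" by (simp add: pW fs.span_base)
      have ea: "ext (wedge m u v) a \<in> R (plucker m W)" "ext (wedge m u v) b \<in> R (plucker m W)"
        unfolding R_def using wp ab by (auto intro!: fs.span_base)
      have "fun_scale D u = fun_scale (u b) (ext (wedge m u v) a) - fun_scale (u a) (ext (wedge m u v) b)"
        unfolding ext_wedge[OF ab(1)] ext_wedge[OF ab(2)]
        by (simp add: fun_eq_iff fun_scale_apply D_def algebra_simps)
      then have "fun_scale D u \<in> R (plucker m W)"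
        using ea unfolding R_def by (simp only: fs.span_diff fs.span_scale)
      then have "fun_scale (inverse D) (fun_scale D u) \<in> R (plucker m W)"
        unfolding R_def by (rule fs.span_scale)
      then have "u \<in> R (plucker m W)" using D by simp
      moreover have "fun_scale D v = fun_scale (v b) (ext (wedge m u v) a) - fun_scale (v a) (ext (wedge m u v) b)"
        unfolding ext_wedge[OF ab(1)] ext_wedge[OF ab(2)]
        by (simp add: fun_eq_iff fun_scale_apply D_def algebra_simps)
      then have "fun_scale D v \<in> R (plucker m W)"
        using ea unfolding R_def by (simp only: fs.span_diff fs.span_scale)
      then have "fun_scale (inverse D) (fun_scale D v) \<in> R (plucker m W)"
        unfolding R_def by (rule fs.span_scale)
      then have "v \<in> R (plucker m W)" using D by simp
      ultimately have "fs.span {u, v} \<subseteq> R (plucker m W)"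
        unfolding R_def by (intro fs.span_minimal) auto
      then show "W \<subseteq> R (plucker m W)" using uv by simp
    qed
  qed
  then show ?thesis by (metis inj_onI)
qed

section \<open>Schubert conditions in Pluecker coordinates\<close>

lemma dim_ge_1_iff:
  assumes "finite I" "S \<subseteq> supported I"
  shows "fs.dim S \<ge> 1 \<longleftrightarrow> (\<exists>x\<in>S. x \<noteq> 0)"
proof -
  obtain B where B: "B \<subseteq> S" "fs.independent B" "S \<subseteq> fs.span B" "finite B" "card B = fs.dim S"
    by (rule supported_basis[OF assms])
  have "0 \<notin> B" using B(2) fs.dependent_zero by blast
  then have "B \<noteq> {} \<longleftrightarrow> (\<exists>x\<in>S. x \<noteq> 0)"
    using B(1,3) fs.span_empty by (metis all_not_in_conv singletonD subsetD)
  moreover have "B \<noteq> {} \<longleftrightarrow> fs.dim S \<ge> 1"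
    using B(4,5) card_0_eq[of B] by linarith
  ultimately show ?thesis by blast
qed

lemma dim_Int_ge_2_iff:
  assumes "W \<in> grassmannian m" "fs.subspace F"
  shows "fs.dim (W \<inter> F) \<ge> 2 \<longleftrightarrow> W \<subseteq> F"
proof
  assume "W \<subseteq> F"
  then have "W \<inter> F = W" by auto
  then show "fs.dim (W \<inter> F) \<ge> 2" using assms by (simp add: grassmannian_def)
next
  assume d: "fs.dim (W \<inter> F) \<ge> 2"
  have W: "fs.subspace W" "W \<subseteq> supported {1..m}" "fs.dim W = 2"
    using assms by (auto simp: grassmannian_def flag_eq_supported)
  obtain B where B: "B \<subseteq> W \<inter> F" "fs.independent B" "W \<inter> F \<subseteq> fs.span B" "finite B"
      "card B = fs.dim (W \<inter> F)"
    using supported_basis[of "{1..m}" "W \<inter> F"] W by auto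
  obtain C where C: "C \<subseteq> W" "fs.independent C" "W \<subseteq> fs.span C" "finite C" "card C = 2"
    using supported_basis[of "{1..m}" W] W by auto
  show "W \<subseteq> F"
  proof (rule ccontr)
    assume "\<not> W \<subseteq> F"
    then obtain w where w: "w \<in> W" "w \<notin> F" by auto
    \<comment> \<open>A vector of \<open>W\<close> outside \<open>F\<close> would extend a basis of
      \<open>W \<inter> F\<close> to three independent vectors in the plane
      \<open>W\<close>.\<close>
    have "fs.span B \<subseteq> F" using B(1) assms(2) by (intro fs.span_minimal) auto
    then have "w \<notin> fs.span B" using w by auto
    then have "fs.independent (insert w B)" using B(2) fs.independent_insertI by blast
    then have "card (insert w B) \<le> card C"
      using fs.independent_span_bound[OF C(4)] B(1) C(3) w by blast
    moreover have "w \<notin> B" using w B by auto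
    ultimately show False using B(4,5) d C(5) by simp
  qed
qed

text \<open>The componentwise order on \<open>I2 m\<close> is the order of inclusion of Schubert
  varieties, so down-sets are the natural index sets of Schubert unions.\<close>

definition downset :: "nat \<Rightarrow> (nat \<times> nat) set \<Rightarrow> bool" where
  "downset m U \<longleftrightarrow> U \<subseteq> I2 m \<and>
     (\<forall>a b c d. (a, b) \<in> U \<longrightarrow> (c, d) \<in> I2 m \<longrightarrow> c \<le> a \<longrightarrow> d \<le> b \<longrightarrow> (c, d) \<in> U)"

lemma supported_Suc_imp:
  "x \<in> supported {1..Suc j} \<Longrightarrow> x (Suc j) = 0 \<Longrightarrow> x \<in> supported {1..j}"
  by (auto simp: supported_def) (metis le_SucE)

lemma schubert_variety_iff:
  assumes "W \<in> grassmannian m"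
  shows "W \<in> schubert_variety m (a, b) \<longleftrightarrow>
    (\<exists>x\<in>W \<inter> supported {1..a}. x \<noteq> 0) \<and> W \<subseteq> supported {1..b}"
  using assms dim_ge_1_iff[of "{1..a}" "W \<inter> supported {1..a}"]
    dim_Int_ge_2_iff[OF assms, of "supported {1..b}"]
  by (simp add: schubert_variety_def flag_eq_supported)

text \<open>Wedge a nonzero \<open>x \<in> W\<close> lying in step \<open>a\<close> of the flag with
  any \<open>y \<in> W\<close>. A nonzero coordinate \<open>(c, d)\<close> needs
  \<open>c \<le> a\<close>, since otherwise \<open>x\<close> vanishes at both positions, and
  \<open>d \<le> b\<close>; so \<open>(c, d)\<close> is in the down-set. As \<open>x\<close> is
  nonzero, \<open>x \<and> v\<close> or \<open>x \<and> u\<close> is a nonzero multiple of the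
  Pluecker vector.\<close>

lemma plucker_subset_if_schubert:
  assumes W: "W \<in> grassmannian m" "W \<in> schubert_variety m (a, b)"
    and U: "downset m U" "(a, b) \<in> U"
  shows "plucker m W \<subseteq> supported U"
proof -
  obtain u v where uv: "W = fs.span {u, v}" "wedge m u v \<noteq> 0" using W(1) by (rule grassmannianE)
  obtain x where x: "x \<in> W" "x \<in> supported {1..a}" "x \<noteq> 0" and Wb: "W \<subseteq> supported {1..b}"
    using W schubert_variety_iff by blast
  obtain \<alpha> \<beta> where ab: "x = fun_scale \<alpha> u + fun_scale \<beta> v" using x(1) uv mem_span_pair by blast
  have *: "wedge m x y (c, d) = 0" if "y \<in> W" "(c, d) \<notin> U" for y c d
  proof (cases "(c, d) \<in> I2 m \<and> c \<le> a")
    case True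
    then have "\<not> d \<le> b" using U that by (auto simp: downset_def)
    then have "x d = 0" "y d = 0" using Wb x that by (auto simp: supported_def)
    then show ?thesis by (simp add: wedge_def)
  next
    case False
    show ?thesis
    proof (cases "(c, d) \<in> I2 m")
      case True
      then have "x c = 0" "x d = 0" using False x by (auto simp: supported_def I2_def)
      then show ?thesis by (simp add: wedge_def)
    qed (simp add: wedge_def)
  qed
  have uvW: "u \<in> W" "v \<in> W" using uv by (auto intro: fs.span_base)
  have 1: "wedge m x v = fun_scale \<alpha> (wedge m u v)"
    using wedge_comb[of m \<alpha> u \<beta> v 0 1] by (simp add: ab)
  have 2: "wedge m x u = fun_scale (- \<beta>) (wedge m u v)"
    using wedge_comb[of m \<alpha> u \<beta> v 1 0] by (simp add: ab)
  have "\<alpha> \<noteq> 0 \<or> \<beta> \<noteq> 0" using x(3) ab by auto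
  then have "wedge m u v (c, d) = 0" if "(c, d) \<notin> U" for c d
    using *[OF uvW(2) that] *[OF uvW(1) that] 1 2 by (auto simp: fun_scale_apply)
  then have "wedge m u v \<in> supported U" by (auto simp: supported_def)
  then show ?thesis unfolding uv(1) plucker_subset_iff[OF subspace_supported] .
qed

text \<open>The pivots of a reduced echelon basis of \<open>W\<close> form a pair in \<open>U\<close>.\<close>

lemma schubert_if_plucker_subset:
  assumes W: "W \<in> grassmannian m" and P: "plucker m W \<subseteq> supported U"
  shows "\<exists>a b. (a, b) \<in> U \<and> W \<in> schubert_variety m (a, b)"
proof -
  obtain u v where uv: "W = fs.span {u, v}" "wedge m u v \<noteq> 0" using W by (rule grassmannianE)
  have uvW: "u \<in> W" "v \<in> W" using uv by (auto intro: fs.span_base)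
  have sW: "fs.subspace W" using uv by simp
  have Wm: "W \<subseteq> supported {1..m}" using W by (auto simp: grassmannian_def flag_eq_supported)
  have uv0: "u \<noteq> 0" using uv(2) by (auto simp: wedge_eq_0_iff)
  \<comment> \<open>Pivots are last nonzero positions: \<open>b\<close> is the first flag step that
    contains \<open>W\<close>, and \<open>a\<close> the first that contains a nonzero vector of
    \<open>W\<close>.\<close>
  define b where "b = (LEAST b. W \<subseteq> supported {1..b})"
  have b: "W \<subseteq> supported {1..b}" unfolding b_def by (rule LeastI[of _ m]) (rule Wm)
  have bm: "b \<le> m" unfolding b_def by (rule Least_le) (rule Wm)
  have bmin: "b \<le> j" if "W \<subseteq> supported {1..j}" for j unfolding b_def using that by (rule Least_le)
  let ?Q = "\<lambda>a. \<exists>x\<in>W \<inter> supported {1..a}. x \<noteq> 0"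
  define a where "a = (LEAST a. ?Q a)"
  have "?Q b" using b uvW uv0 by auto
  then have a: "?Q a" and ab: "a \<le> b" unfolding a_def by (rule LeastI, rule Least_le)
  have amin: "a \<le> j" if "?Q j" for j unfolding a_def using that by (rule Least_le)
  obtain x where x: "x \<in> W" "x \<in> supported {1..a}" "x \<noteq> 0" using a by auto
  obtain a' where a': "a = Suc a'"
    using x by (cases a) (auto simp: supported_def fun_eq_iff)
  obtain b' where b': "b = Suc b'" using ab a' by (cases b) auto
  have xa: "x a \<noteq> 0" using supported_Suc_imp[of x a'] x amin[of a'] a' by auto
  have "\<not> W \<subseteq> supported {1..b'}" using bmin[of b'] b' by auto
  then obtain y where y: "y \<in> W" "y \<notin> supported {1..b'}" by auto
  have yb: "y b \<noteq> 0" using supported_Suc_imp[of y b'] y b b' by auto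
  have "a \<noteq> b"
  proof
    assume eq: "a = b"
    \<comment> \<open>Eliminating coordinate \<open>b\<close> puts \<open>z\<close> one flag step
      lower. If \<open>a = b\<close>, minimality of \<open>a\<close> gives \<open>z = 0\<close>, so
      all of \<open>W\<close> vanishes at \<open>b\<close>, against the choice of
      \<open>y\<close>.\<close>
    define z where "z = fun_scale (v b) u + fun_scale (- u b) v"
    have zW: "z \<in> W" unfolding uv(1) mem_span_pair z_def by blast
    have "z b = 0" by (simp add: z_def fun_scale_apply)
    then have "z \<in> supported {1..b'}" using supported_Suc_imp[of z b'] zW b b' by auto
    then have "z = 0" using amin[of b'] zW eq b' by auto
    then have z0: "wedge m z v = 0" "wedge m z u = 0" by (auto simp: wedge_eq_0_iff)
    have "wedge m z v = fun_scale (v b) (wedge m u v)"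
      using wedge_comb[of m "v b" u "- u b" v 0 1] by (simp add: z_def)
    then have "v b = 0" using z0 uv(2) by simp
    have "wedge m z u = fun_scale (u b) (wedge m u v)"
      using wedge_comb[of m "v b" u "- u b" v 1 0] by (simp add: z_def)
    then have "u b = 0" using z0 uv(2) by simp
    have "y b = 0" using y(1) \<open>v b = 0\<close> \<open>u b = 0\<close> unfolding uv(1) mem_span_pair
      by (auto simp: fun_scale_apply)
    with yb show False by simp
  qed
  with ab have "a < b" by simp
  then have I: "(a, b) \<in> I2 m" using a' bm by (auto simp: I2_def)
  \<comment> \<open>This reduces the minor at \<open>(a, b)\<close> to the product
    \<open>x a * y b\<close> of the pivots.\<close>
  have "x b = 0" using x(2) \<open>a < b\<close> by (auto simp: supported_def)
  then have "wedge m x y (a, b) \<noteq> 0" using I xa yb by (simp add: wedge_def)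
  moreover have "wedge m x y \<in> plucker m W" unfolding plucker_def using x y by (auto intro!: fs.span_base)
  ultimately have "(a, b) \<in> U" using P by (auto simp: supported_def)
  moreover have "W \<in> schubert_variety m (a, b)" using schubert_variety_iff[OF W] x b by blast
  ultimately show ?thesis by blast
qed

lemma schubert_union_eq:
  assumes "downset m U"
  shows "schubert_union m U = {W \<in> grassmannian m. plucker m W \<subseteq> supported U}"
proof -
  have "schubert_variety m \<alpha> \<subseteq> grassmannian m" for \<alpha>
    by (cases \<alpha>) (auto simp: schubert_variety_def)
  then show ?thesis
    unfolding schubert_union_def
    using plucker_subset_if_schubert[OF _ _ assms] schubert_if_plucker_subset[where m=m and U=U]
    by fast
qed

lemma schubert_union_section:
  assumes "downset m U"
  shows "proj_points (supported U) \<inter> plucker m ` grassmannian m = plucker m ` schubert_union m U"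
  by (simp add: proj_points_section schubert_union_eq[OF assms])

section \<open>Counting pairs of vectors\<close>

text \<open>Pairs with \<open>u \<and> v = 0\<close> are kept in the count. They lie in the set for
  every subspace \<open>L\<close>, and the injections below need not avoid them.\<close>

definition wedge_pairs :: "nat \<Rightarrow> (nat \<times> nat \<Rightarrow> 'a::field) set \<Rightarrow> ((nat \<Rightarrow> 'a) \<times> (nat \<Rightarrow> 'a)) set" where
  "wedge_pairs m L = {(u, v). u \<in> flag m \<and> v \<in> flag m \<and> wedge m u v \<in> L}"

definition sections :: "nat \<Rightarrow> (nat \<times> nat \<Rightarrow> 'a::field) set \<Rightarrow> (nat \<Rightarrow> 'a) set set" where
  "sections m L = {W \<in> grassmannian m. plucker m W \<subseteq> L}"

lemma finite_flag [simp]: "finite (flag m :: (nat \<Rightarrow> 'a::{field,finite}) set)"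
  by (simp add: flag_eq_supported finite_supported)

lemma finite_grassmannian [simp]: "finite (grassmannian m :: (nat \<Rightarrow> 'a::{field,finite}) set set)"
proof (rule finite_subset)
  show "grassmannian m \<subseteq> Pow (flag m :: (nat \<Rightarrow> 'a) set)" by (auto simp: grassmannian_def)
qed simp

lemma finite_sections [simp]: "finite (sections m (L :: (nat \<times> nat \<Rightarrow> 'a::{field,finite}) set))"
  by (simp add: sections_def)

lemma finite_wedge_pairs [simp]: "finite (wedge_pairs m (L :: (nat \<times> nat \<Rightarrow> 'a::{field,finite}) set))"
proof (rule finite_subset)
  show "wedge_pairs m L \<subseteq> flag m \<times> flag m" by (auto simp: wedge_pairs_def)
qed simp

lemma wedge_pairs_mono: "L \<subseteq> L' \<Longrightarrow> wedge_pairs m L \<subseteq> wedge_pairs m L'"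
  by (auto simp: wedge_pairs_def)

lemma card_proj_points_section:
  "card (proj_points L \<inter> plucker m ` grassmannian m) = card (sections m L)"
  unfolding proj_points_section sections_def
  by (rule card_image) (rule inj_on_subset[OF inj_on_plucker], blast)

lemma plucker_eq_span_wedge:
  assumes "W \<in> grassmannian m" "x \<in> W" "y \<in> W" "wedge m x y \<noteq> 0"
  shows "plucker m W = fs.span {wedge m x y}"
proof -
  obtain u v where uv: "W = fs.span {u, v}" using assms(1) by (rule grassmannianE)
  obtain \<alpha> \<beta> \<gamma> \<delta> where
    xy: "x = fun_scale \<alpha> u + fun_scale \<beta> v" "y = fun_scale \<gamma> u + fun_scale \<delta> v"
    using assms(2,3) unfolding uv mem_span_pair by blast
  have w: "wedge m x y = fun_scale (\<alpha> * \<delta> - \<beta> * \<gamma>) (wedge m u v)"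
    unfolding xy by (rule wedge_comb)
  then have "\<alpha> * \<delta> - \<beta> * \<gamma> \<noteq> 0" using assms(4) by auto
  then have "fs.span {wedge m u v} = fs.span {wedge m x y}"
    unfolding w by (subst fs.span_eq)
      (auto simp: fs.span_singleton intro: rangeI range_eqI[of _ _ "inverse (\<alpha> * \<delta> - \<beta> * \<gamma>)"])
  then show ?thesis unfolding uv plucker_span .
qed

text \<open>The order of GL_2 over \<open>'a\<close>, which is the number of ordered bases of a
  plane.\<close>

definition bases_count :: "'a::{field,finite} itself \<Rightarrow> nat" where
  "bases_count _ = card {((\<alpha>, \<beta>), (\<gamma>, \<delta>)) | \<alpha> \<beta> \<gamma> \<delta> :: 'a. \<alpha> * \<delta> - \<beta> * \<gamma> \<noteq> 0}"

lemma bases_count_pos: "bases_count TYPE('a::{field,finite}) > 0"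
proof -
  have "((1, 0), (0, 1)) \<in> {((\<alpha>, \<beta>), (\<gamma>, \<delta>)) | \<alpha> \<beta> \<gamma> \<delta> :: 'a. \<alpha> * \<delta> - \<beta> * \<gamma> \<noteq> 0}"
    by simp
  then show ?thesis unfolding bases_count_def by (intro card_gt_0_iff[THEN iffD2] conjI finite) blast
qed

lemma card_bases:
  assumes "W \<in> (grassmannian m :: (nat \<Rightarrow> 'a::{field,finite}) set set)"
  shows "card {(x, y). x \<in> W \<and> y \<in> W \<and> wedge m x y \<noteq> 0} = bases_count TYPE('a)"
proof -
  obtain u v where uv: "W = fs.span {u, v}" "wedge m u v \<noteq> 0" using assms by (rule grassmannianE)
  define f where "f = (\<lambda>p :: 'a \<times> 'a. fun_scale (fst p) u + fun_scale (snd p) v)"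
  have w1: "wedge m (f p) v = fun_scale (fst p) (wedge m u v)" for p
    unfolding f_def using wedge_comb[of m "fst p" u "snd p" v 0 1] by simp
  have w2: "wedge m u (f p) = fun_scale (snd p) (wedge m u v)" for p
    unfolding f_def using wedge_comb[of m 1 u 0 v "fst p" "snd p"] by simp
  have "inj f"
  proof (rule injI)
    fix p p' assume "f p = f p'"
    then have "fst p = fst p'" "snd p = snd p'"
      using w1[of p] w1[of p'] w2[of p] w2[of p'] uv(2) by auto
    then show "p = p'" by (rule prod_eqI)
  qed
  have ran: "x \<in> W \<longleftrightarrow> (\<exists>p. x = f p)" for x
    unfolding uv(1) mem_span_pair f_def by simp
  have w: "wedge m (f p) (f p') = fun_scale (fst p * snd p' - snd p * fst p') (wedge m u v)" for p p'
    unfolding f_def by (rule wedge_comb)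
  let ?S = "{((\<alpha>, \<beta>), (\<gamma>, \<delta>)) | \<alpha> \<beta> \<gamma> \<delta> :: 'a. \<alpha> * \<delta> - \<beta> * \<gamma> \<noteq> 0}"
  have "{(x, y). x \<in> W \<and> y \<in> W \<and> wedge m x y \<noteq> 0} = map_prod f f ` ?S" (is "?B = _")
  proof (intro equalityI subsetI)
    fix z assume "z \<in> ?B"
    then obtain p p' where z: "z = (f p, f p')" "wedge m (f p) (f p') \<noteq> 0"
      using ran by (cases z) auto
    then have "fst p * snd p' - snd p * fst p' \<noteq> 0" using w[of p p'] by auto
    then have "(p, p') \<in> ?S" by (cases p; cases p') simp
    then show "z \<in> map_prod f f ` ?S" using z by (intro image_eqI[of _ _ "(p, p')"]) simp_all
  next
    fix z assume "z \<in> map_prod f f ` ?S"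
    then obtain p p' where z: "z = (f p, f p')" "fst p * snd p' - snd p * fst p' \<noteq> 0" by auto
    have "wedge m (f p) (f p') \<noteq> 0" unfolding w using z(2) uv(2) by simp
    then show "z \<in> ?B" using z(1) ran[of "f p"] ran[of "f p'"] by blast
  qed
  moreover have "inj_on (map_prod f f) ?S"
    by (rule inj_on_subset[OF prod.inj_map[OF \<open>inj f\<close> \<open>inj f\<close>] subset_UNIV])
  ultimately show ?thesis unfolding bases_count_def by (simp only: card_image)
qed

text \<open>Each pair with nonzero wedge is an ordered basis of exactly one plane, and that plane is
  a section of \<open>L\<close> iff the wedge lies in \<open>L\<close>. Disjointness of the
  contributions comes from injectivity of the Pluecker map.\<close>

lemma card_wedge_pairs:
  fixes L :: "(nat \<times> nat \<Rightarrow> 'a::{field,finite}) set"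
  assumes L: "fs.subspace L"
  shows "card (wedge_pairs m L)
    = card (wedge_pairs m {0 :: nat \<times> nat \<Rightarrow> 'a}) + bases_count TYPE('a) * card (sections m L)"
proof -
  define T where "T = (\<lambda>W :: (nat \<Rightarrow> 'a) set. {(x, y). x \<in> W \<and> y \<in> W \<and> wedge m x y \<noteq> 0})"
  have dec: "wedge_pairs m L = wedge_pairs m {0} \<union> (\<Union>W\<in>sections m L. T W)"
  proof (intro equalityI subsetI)
    fix z assume z: "z \<in> wedge_pairs m L"
    obtain x y where xy: "z = (x, y)" "x \<in> flag m" "y \<in> flag m" "wedge m x y \<in> L"
      using z by (auto simp: wedge_pairs_def)
    show "z \<in> wedge_pairs m {0} \<union> (\<Union>W\<in>sections m L. T W)"
    proof (cases "wedge m x y = 0")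
      case True
      then show ?thesis using xy by (simp add: wedge_pairs_def)
    next
      case False
      have "fs.span {x, y} \<in> sections m L"
        using xy False span_pair_in_grassmannian plucker_subset_iff[OF L] by (simp add: sections_def)
      moreover have "z \<in> T (fs.span {x, y})"
        using xy False by (simp add: T_def fs.span_base)
      ultimately show ?thesis by blast
    qed
  next
    fix z assume "z \<in> wedge_pairs m {0} \<union> (\<Union>W\<in>sections m L. T W)"
    then show "z \<in> wedge_pairs m L"
    proof
      assume "z \<in> wedge_pairs m {0}"
      then show ?thesis using fs.subspace_0[OF L] by (auto simp: wedge_pairs_def)
    next
      assume "z \<in> (\<Union>W\<in>sections m L. T W)"
      then obtain W x y where W: "W \<in> grassmannian m" "plucker m W \<subseteq> L" "z = (x, y)"
        "x \<in> W" "y \<in> W" by (auto simp: sections_def T_def)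
      moreover have "wedge m x y \<in> plucker m W"
        unfolding plucker_def using W by (intro fs.span_base) blast
      ultimately show ?thesis by (auto simp: wedge_pairs_def grassmannian_def)
    qed
  qed
  have finT: "finite (T W)" if "W \<in> sections m L" for W
  proof (rule finite_subset)
    show "T W \<subseteq> flag m \<times> flag m" using that by (auto simp: T_def sections_def grassmannian_def)
  qed simp
  have disj: "T W \<inter> T W' = {}" if "W \<in> sections m L" "W' \<in> sections m L" "W \<noteq> W'" for W W'
  proof (rule ccontr)
    assume "T W \<inter> T W' \<noteq> {}"
    then obtain x y where "x \<in> W" "y \<in> W" "x \<in> W'" "y \<in> W'" "wedge m x y \<noteq> 0" by (auto simp: T_def)
    then have "plucker m W = plucker m W'"
      using that plucker_eq_span_wedge[of W m x y] plucker_eq_span_wedge[of W' m x y]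
      by (simp add: sections_def)
    then have "W = W'"
      by (rule inj_onD[OF inj_on_plucker]) (use that in \<open>simp_all add: sections_def\<close>)
    then show False using that(3) by contradiction
  qed
  have "card (wedge_pairs m L) = card (wedge_pairs m {0 :: nat \<times> nat \<Rightarrow> 'a}) + card (\<Union>W\<in>sections m L. T W)"
    unfolding dec
  proof (rule card_Un_disjoint)
    show "finite (\<Union>W\<in>sections m L. T W)" using finT by simp
    show "wedge_pairs m {0} \<inter> (\<Union>W\<in>sections m L. T W) = {}" by (auto simp: T_def wedge_pairs_def)
  qed simp
  also have "card (\<Union>W\<in>sections m L. T W) = (\<Sum>W\<in>sections m L. card (T W))"
    by (rule card_UN_disjoint) (use finT disj in auto)
  also have "\<dots> = (\<Sum>W\<in>sections m L. bases_count TYPE('a))"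
    by (rule sum.cong) (auto simp: T_def sections_def card_bases)
  finally show ?thesis unfolding sum_constant by (simp only: of_nat_id mult.commute)
qed

lemma card_sections_mono:
  fixes L L' :: "(nat \<times> nat \<Rightarrow> 'a::{field,finite}) set"
  assumes "fs.subspace L" "fs.subspace L'" "card (wedge_pairs m L) \<le> card (wedge_pairs m L')"
  shows "card (sections m L) \<le> card (sections m L')"
  using assms(3) bases_count_pos[where 'a='a]
  unfolding card_wedge_pairs[OF assms(1)] card_wedge_pairs[OF assms(2)] by simp

section \<open>Degeneration to coordinate subspaces\<close>

text \<open>The component of weight 1 under the torus that scales \<open>e_c\<close>; what remains
  of \<open>x\<close> has weight 0. The name refers to the edges at vertex \<open>c\<close>.\<close>

definition star_part :: "nat \<Rightarrow> (nat \<times> nat \<Rightarrow> 'a::field) \<Rightarrow> nat \<times> nat \<Rightarrow> 'a" where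
  "star_part c x = (\<lambda>(a, b). if a = c \<or> b = c then x (a, b) else 0)"

text \<open>The limit of \<open>L\<close> under the one-parameter torus that scales \<open>e\<^sub>c\<close>.\<close>

definition degenerate :: "nat \<Rightarrow> (nat \<times> nat \<Rightarrow> 'a::field) set \<Rightarrow> (nat \<times> nat \<Rightarrow> 'a) set" where
  "degenerate c L = {star_part c x + y | x y. x \<in> L \<and> y \<in> L \<and> star_part c y = 0}"

lemma star_part_add: "star_part c (x + y) = star_part c x + star_part c y"
  by (auto simp: star_part_def fun_eq_iff)

lemma star_part_scale: "star_part c (fun_scale k x) = fun_scale k (star_part c x)"
  by (auto simp: star_part_def fun_eq_iff fun_scale_apply)

lemma star_part_0 [simp]: "star_part c 0 = 0"
  by (auto simp: star_part_def fun_eq_iff)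

lemma star_part_idem [simp]: "star_part c (star_part c x) = star_part c x"
  by (auto simp: star_part_def fun_eq_iff)

lemma star_part_commute: "star_part c (star_part d x) = star_part d (star_part c x)"
  by (auto simp: star_part_def fun_eq_iff)

lemma star_part_in_supported: "x \<in> supported I \<Longrightarrow> star_part c x \<in> supported I"
  by (auto simp: star_part_def supported_def)

lemma degenerateI: "x \<in> L \<Longrightarrow> y \<in> L \<Longrightarrow> star_part c y = 0 \<Longrightarrow> star_part c x + y \<in> degenerate c L"
  unfolding degenerate_def by blast

lemma degenerateE:
  assumes "z \<in> degenerate c L"
  obtains x y where "z = star_part c x + y" "x \<in> L" "y \<in> L" "star_part c y = 0"
  using assms unfolding degenerate_def by blast

lemma subspace_degenerate:
  assumes L: "fs.subspace L"
  shows "fs.subspace (degenerate c L)"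
proof (rule fs.subspaceI)
  show "0 \<in> degenerate c L"
    using degenerateI[of 0 L 0 c] fs.subspace_0[OF L] by simp
next
  fix z z' assume "z \<in> degenerate c L" "z' \<in> degenerate c L"
  then obtain x y x' y' where *: "z = star_part c x + y" "x \<in> L" "y \<in> L" "star_part c y = 0"
    "z' = star_part c x' + y'" "x' \<in> L" "y' \<in> L" "star_part c y' = 0"
    by (elim degenerateE) blast
  have "z + z' = star_part c (x + x') + (y + y')"
    unfolding * star_part_add by (simp add: algebra_simps)
  moreover have "star_part c (x + x') + (y + y') \<in> degenerate c L"
    using * by (intro degenerateI fs.subspace_add[OF L]) (simp_all add: star_part_add)
  ultimately show "z + z' \<in> degenerate c L" by metis
next
  fix k z assume "z \<in> degenerate c L"
  then obtain x y where *: "z = star_part c x + y" "x \<in> L" "y \<in> L" "star_part c y = 0"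
    by (elim degenerateE) blast
  have "fun_scale k z = star_part c (fun_scale k x) + fun_scale k y"
    unfolding * star_part_scale by (rule fs.scale_right_distrib)
  moreover have "star_part c (fun_scale k x) + fun_scale k y \<in> degenerate c L"
    using * by (intro degenerateI fs.subspace_scale[OF L]) (simp_all add: star_part_scale)
  ultimately show "fun_scale k z \<in> degenerate c L" by metis
qed

lemma degenerate_subset_supported:
  assumes "L \<subseteq> supported I"
  shows "degenerate c L \<subseteq> supported I"
proof
  fix z assume "z \<in> degenerate c L"
  then obtain x y where "z = star_part c x + y" "x \<in> L" "y \<in> L" by (rule degenerateE)
  then show "z \<in> supported I"
    using assms star_part_in_supported[of x I c] fs.subspace_add[OF subspace_supported] by blast
qed

text \<open>Rank and nullity as an injection: replace the star part of \<open>z\<close> by a chosen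
  preimage \<open>s\<close> in \<open>L\<close> and keep the rest of \<open>z\<close>. The result
  has the same star part, so \<open>z\<close> can be recovered.\<close>

lemma card_degenerate_le:
  assumes L: "fs.subspace L" "finite L"
  shows "card (degenerate c L) \<le> card L"
proof -
  define s where "s = (\<lambda>p. SOME x. x \<in> L \<and> star_part c x = p)"
  have s: "s (star_part c x) \<in> L" "star_part c (s (star_part c x)) = star_part c x" if "x \<in> L" for x
    using someI[of "\<lambda>x'. x' \<in> L \<and> star_part c x' = star_part c x" x] that unfolding s_def by auto
  define f where "f = (\<lambda>z. s (star_part c z) + (z - star_part c z))"
  have f: "f z \<in> L \<and> star_part c (f z) = star_part c z \<and> f z - s (star_part c z) + star_part c z = z"
    if z: "z \<in> degenerate c L" for z
  proof -
    obtain x y where xy: "z = star_part c x + y" "x \<in> L" "y \<in> L" "star_part c y = 0"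
      using z by (rule degenerateE)
    have p: "star_part c z = star_part c x" unfolding xy star_part_add by (simp add: xy(4))
    have "f z = s (star_part c x) + y" unfolding f_def p using xy(1) by simp
    then show ?thesis
      using s[OF xy(2)] xy p fs.subspace_add[OF L(1)] by (simp add: star_part_add)
  qed
  show ?thesis
  proof (rule card_inj_on_le[of f])
    show "inj_on f (degenerate c L)" by (rule inj_onI) (metis f)
    show "f ` degenerate c L \<subseteq> L" using f by blast
  qed (rule L)
qed

text \<open>The terms of \<open>u \<and> v\<close> that involve \<open>e_c\<close> collect to
  \<open>e_c \<and> (u_c v - v_c u)\<close>, so the star part depends only on the vector
  \<open>w\<close> by which pairs are grouped below.\<close>

lemma star_part_wedge:
  "star_part c (wedge m u v) = wedge m (unit_vec c) (fun_scale (u c) v - fun_scale (v c) u)"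
  by (auto simp: star_part_def wedge_def unit_vec_def fun_scale_apply fun_eq_iff I2_def)

lemma wedge_translate:
  "wedge m (u + fun_scale s g) (v + fun_scale t g)
     = wedge m u v + wedge m g (fun_scale s v - fun_scale t u)"
  by (auto simp: wedge_def fun_scale_apply fun_eq_iff algebra_simps)

text \<open>Pairs \<open>(u, v)\<close> are grouped by \<open>s = u\<^sub>c\<close>, \<open>t = v\<^sub>c\<close> and \<open>w = s v - t u\<close>.  For
  \<open>(s, t) \<noteq> 0\<close> each group is one orbit of the translations \<open>(u, v) \<mapsto> (u + s g, v + t g)\<close>, \<open>g\<^sub>c = 0\<close>,
  and a translation changes \<open>u \<and> v\<close> by \<open>g \<and> w\<close>, which does not involve \<open>e\<^sub>c\<close>.\<close>

lemma card_wedge_pairs_degenerate: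
  fixes L :: "(nat \<times> nat \<Rightarrow> 'a::{field,finite}) set"
  assumes L: "fs.subspace L" and c: "c \<in> {1..m}"
  shows "card (wedge_pairs m L) \<le> card (wedge_pairs m (degenerate c L))"
proof -
  define e where "e = (unit_vec c :: nat \<Rightarrow> 'a)"
  have e: "e \<in> flag m" "e c = 1" using c by (simp_all add: e_def flag_eq_supported) (simp add: unit_vec_def)
  define wv where "wv = (\<lambda>(u :: nat \<Rightarrow> 'a) v. fun_scale (u c) v - fun_scale (v c) u)"
  define key where "key = (\<lambda>(u, v). (u c, v c, wv u v))"
  \<comment> \<open>A normal form for each group with \<open>(s, t) \<noteq> 0\<close>: a pair whose
    wedge is exactly \<open>e_c \<and> w\<close>, with no component of weight 0. The case split only
    decides whether to divide by \<open>s\<close> or by \<open>t\<close>.\<close>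
  define base where "base = (\<lambda>(s, t, w). if s \<noteq> 0 then (fun_scale s e, fun_scale t e + fun_scale (inverse s) w)
      else (fun_scale (- inverse t) w, fun_scale t e))"
  have wv_c: "wv u v c = 0" for u v by (simp add: wv_def fun_scale_apply)
  have wv_flag: "wv u v \<in> flag m" if "u \<in> flag m" "v \<in> flag m" for u v
    unfolding wv_def using that by (intro fs.subspace_diff fs.subspace_scale) simp_all
  have base: "fst (base (s, t, w)) \<in> flag m \<and> snd (base (s, t, w)) \<in> flag m
      \<and> key (base (s, t, w)) = (s, t, w) \<and> wedge m (fst (base (s, t, w))) (snd (base (s, t, w))) = wedge m e w"
    if st: "s \<noteq> 0 \<or> t \<noteq> 0" and w: "w \<in> flag m" "w c = 0" for s t w
  proof (cases "s = 0")
    case False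
    then have b: "base (s, t, w) = (fun_scale s e, fun_scale t e + fun_scale (inverse s) w)"
      by (simp add: base_def)
    have "wv (fst (base (s, t, w))) (snd (base (s, t, w))) = w"
      unfolding b wv_def using e w False by (auto simp: fun_eq_iff fun_scale_apply field_simps)
    moreover have "wedge m (fun_scale s e) (fun_scale t e + fun_scale (inverse s) w) = wedge m e w"
      using wedge_comb[of m s e 0 w t "inverse s"] False by simp
    moreover have "fun_scale s e \<in> flag m" "fun_scale t e + fun_scale (inverse s) w \<in> flag m"
      using e w by (intro fs.subspace_scale fs.subspace_add; simp)+
    ultimately show ?thesis using e w unfolding b by (simp add: key_def fun_scale_apply)
  next
    case True
    then have b: "base (s, t, w) = (fun_scale (- inverse t) w, fun_scale t e)" by (simp add: base_def)
    have t: "t \<noteq> 0" using st True by simp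
    have "wv (fst (base (s, t, w))) (snd (base (s, t, w))) = w"
      unfolding b wv_def using e w t by (auto simp: fun_eq_iff fun_scale_apply field_simps)
    moreover have "wedge m (fun_scale (- inverse t) w) (fun_scale t e) = wedge m e w"
      using wedge_comb[of m 0 e "- inverse t" w t 0] t by simp
    moreover have "fun_scale (- inverse t) w \<in> flag m" "fun_scale t e \<in> flag m"
      using e w by (intro fs.subspace_scale; simp)+
    ultimately show ?thesis using e w True unfolding b by (simp add: key_def fun_scale_apply)
  qed
  \<comment> \<open>Some member of the group whose wedge already lies in \<open>L\<close>; it serves
    as origin for the translations.\<close>
  define ref where "ref = (\<lambda>k. SOME p. p \<in> wedge_pairs m L \<and> key p = k)"
  have ref: "ref (key p) \<in> wedge_pairs m L \<and> key (ref (key p)) = key p" if "p \<in> wedge_pairs m L" for p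
    unfolding ref_def by (rule someI[of _ p]) (simp add: that)
  \<comment> \<open>\<open>F\<close> applies to the whole group the translation that takes
    \<open>ref\<close> to \<open>base\<close>. Pairs with \<open>u_c = v_c = 0\<close> stay fixed:
    their wedge has no star part and so lies in the limit already.\<close>
  define F where "F = (\<lambda>p. if fst p c = 0 \<and> snd p c = 0 then p else
      (fst p - fst (ref (key p)) + fst (base (key p)), snd p - snd (ref (key p)) + snd (base (key p))))"
  have F: "F p \<in> wedge_pairs m (degenerate c L) \<and> key (F p) = key p" if p: "p \<in> wedge_pairs m L" for p
  proof (cases "fst p c = 0 \<and> snd p c = 0")
    case True
    obtain u v where uv: "p = (u, v)" by (cases p)
    have "star_part c (wedge m u v) = wedge m (unit_vec c) 0"
      unfolding star_part_wedge using True uv by simp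
    also have "\<dots> = 0" by (auto simp: wedge_def fun_eq_iff)
    finally have "star_part c 0 + wedge m u v \<in> degenerate c L"
      using p uv fs.subspace_0[OF L] by (intro degenerateI) (simp_all add: wedge_pairs_def)
    moreover have "F p = p" using True by (simp add: F_def)
    ultimately show ?thesis using p uv by (simp add: wedge_pairs_def)
  next
    case False
    obtain u v where uv: "p = (u, v)" by (cases p)
    obtain u0 v0 where uv0: "ref (key p) = (u0, v0)" by (cases "ref (key p)")
    define s t w where "s = u c" and "t = v c" and "w = wv u v"
    have k: "key p = (s, t, w)" by (simp add: key_def uv s_def t_def w_def)
    have st: "s \<noteq> 0 \<or> t \<noteq> 0" using False uv by (auto simp: s_def t_def)
    have fl: "u \<in> flag m" "v \<in> flag m" "wedge m u v \<in> L" using p uv by (auto simp: wedge_pairs_def)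
    have fl0: "u0 \<in> flag m" "v0 \<in> flag m" "wedge m u0 v0 \<in> L"
      using ref[OF p] uv0 by (auto simp: wedge_pairs_def)
    have k0: "u0 c = s" "v0 c = t" "wv u0 v0 = w" using ref[OF p] uv0 k by (auto simp: key_def)
    have wf: "w \<in> flag m" "w c = 0" unfolding w_def using wv_flag fl wv_c by auto
    obtain u1 v1 where uv1: "base (s, t, w) = (u1, v1)" by (cases "base (s, t, w)")
    have b: "u1 \<in> flag m" "v1 \<in> flag m" "u1 c = s" "v1 c = t" "wv u1 v1 = w" "wedge m u1 v1 = wedge m e w"
      using base[OF st wf] uv1 by (auto simp: key_def)
    have Fp: "F p = (u - u0 + u1, v - v0 + v1)"
      using False uv1 uv0 k unfolding F_def uv by auto
    have dv: "s * (v i - v0 i) = t * (u i - u0 i)" for i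
    proof -
      have "wv u v i = wv u0 v0 i" using k0 by (simp add: w_def)
      then show ?thesis using k0 by (simp add: wv_def fun_scale_apply s_def t_def algebra_simps)
    qed
    \<comment> \<open>The translation from the reference pair to \<open>(u, v)\<close>. Equality of
      the two vectors \<open>w\<close> makes the differences of both components proportional to
      \<open>(s, t)\<close>.\<close>
    define g where "g = (if s \<noteq> 0 then fun_scale (inverse s) (u - u0) else fun_scale (inverse t) (v - v0))"
    have gu: "u - u0 = fun_scale s g"
    proof (cases "s = 0")
      case True
      then have "t \<noteq> 0" using st by simp
      then have "u i - u0 i = 0" for i using dv[of i] True by simp
      then show ?thesis using True by (simp add: fun_eq_iff fun_scale_apply)
    qed (simp add: g_def)
    have gv: "v - v0 = fun_scale t g"
    proof (cases "s = 0")
      case True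
      then show ?thesis using st by (simp add: g_def)
    next
      case s: False
      have "v i - v0 i = t * (inverse s * (u i - u0 i))" for i
        using dv[of i] s by (simp add: field_simps)
      then show ?thesis using s by (simp add: g_def fun_eq_iff fun_scale_apply)
    qed
    have "s * g c = 0" "t * g c = 0"
      using fun_cong[OF gu, of c] fun_cong[OF gv, of c] k0 by (simp_all add: fun_scale_apply s_def t_def)
    then have gc: "g c = 0" using st by auto
    have uu: "u = u0 + fun_scale s g" "v = v0 + fun_scale t g" using gu gv by (simp_all flip: gu gv)
    have "wedge m u v = wedge m u0 v0 + wedge m g w"
      using wedge_translate[of m u0 s g v0 t] k0 unfolding uu[symmetric] by (simp add: wv_def)
    then have "wedge m g w = wedge m u v - wedge m u0 v0" by simp
    then have gL: "wedge m g w \<in> L" using fs.subspace_diff[OF L fl(3) fl0(3)] by simp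
    \<comment> \<open>Thus \<open>g \<and> w\<close> is a difference of two elements of
      \<open>L\<close> and has weight 0, while \<open>e_c \<and> w\<close> is the star part of
      \<open>u \<and> v\<close>. Their sum is of the form that \<open>degenerateI\<close> asks
      for.\<close>
    have "wv g w = 0" using gc wf by (simp add: wv_def)
    then have g0: "star_part c (wedge m g w) = 0"
      unfolding star_part_wedge by (auto simp: wv_def wedge_def fun_eq_iff)
    have "wedge m (fst (F p)) (snd (F p)) = wedge m u1 v1 + wedge m g w"
      using wedge_translate[of m u1 s g v1 t] b unfolding Fp gu gv by (simp add: wv_def add.commute)
    also have "wedge m u1 v1 = star_part c (wedge m u v)"
      unfolding star_part_wedge b(6) by (simp add: w_def wv_def e_def)
    finally have "wedge m (fst (F p)) (snd (F p)) \<in> degenerate c L"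
      using degenerateI[OF fl(3) gL g0] by (simp only:)
    moreover have "u - u0 + u1 \<in> flag m" "v - v0 + v1 \<in> flag m"
      using fl fl0 b by (intro fs.subspace_add fs.subspace_diff; simp)+
    ultimately have "F p \<in> wedge_pairs m (degenerate c L)"
      by (simp add: wedge_pairs_def Fp)
    moreover have "wv (u - u0 + u1) (v - v0 + v1) = w"
    proof
      fix i
      have "(u - u0 + u1) c = s" "(v - v0 + v1) c = t" using b k0 by (simp_all add: s_def t_def)
      then have "wv (u - u0 + u1) (v - v0 + v1) i = (s * v i - t * u i) - (s * v0 i - t * u0 i) + (s * v1 i - t * u1 i)"
        by (simp add: wv_def fun_scale_apply algebra_simps)
      also have "\<dots> = wv u v i - wv u0 v0 i + wv u1 v1 i"
        using b(3,4) k0(1,2) by (simp add: wv_def fun_scale_apply s_def t_def)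
      also have "\<dots> = w i" using k0(3) b(5) by (simp add: w_def)
      finally show "wv (u - u0 + u1) (v - v0 + v1) i = w i" .
    qed
    then have "key (F p) = (s, t, w)"
      unfolding Fp key_def using b k0 by (simp add: s_def t_def)
    ultimately show ?thesis unfolding k by blast
  qed
  show ?thesis
  proof (rule card_inj_on_le[of F])
    show "F ` wedge_pairs m L \<subseteq> wedge_pairs m (degenerate c L)" using F by blast
    show "inj_on F (wedge_pairs m L)"
    proof (rule inj_onI)
      fix p p' assume pp: "p \<in> wedge_pairs m L" "p' \<in> wedge_pairs m L" and eq: "F p = F p'"
      \<comment> \<open>The key determines the branch of \<open>F\<close> and the translation
        applied, so \<open>F\<close> is injective on each group and keeps the groups apart.\<close>
      then have k: "key p = key p'" using F by metis
      then have "fst p c = fst p' c" "snd p c = snd p' c" by (auto simp: key_def split_beta)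
      then have "fst p = fst p' \<and> snd p = snd p'"
        using eq unfolding F_def k by (cases "fst p' c = 0 \<and> snd p' c = 0") auto
      then show "p = p'" by (simp add: prod_eq_iff)
    qed
  qed simp
qed

text \<open>One limit for each of \<open>1..n\<close>. The limit for \<open>Suc n\<close> is closed
  under its own star part because that projection is idempotent, and remains closed under the
  earlier ones because they commute with it.\<close>

lemma degenerate_star_closed:
  fixes L :: "(nat \<times> nat \<Rightarrow> 'a::{field,finite}) set"
  assumes L: "fs.subspace L" "L \<subseteq> supported (I2 m)" and n: "n \<le> m"
  shows "\<exists>L' :: (nat \<times> nat \<Rightarrow> 'a) set. fs.subspace L' \<and> L' \<subseteq> supported (I2 m) \<and> card L' \<le> card L
    \<and> card (wedge_pairs m L) \<le> card (wedge_pairs m L') \<and> (\<forall>c\<in>{1..n}. \<forall>x\<in>L'. star_part c x \<in> L')"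
  using n
proof (induction n)
  case 0
  show ?case using L by (intro exI[of _ L]) simp
next
  case (Suc n)
  then obtain L' :: "(nat \<times> nat \<Rightarrow> 'a) set" where L': "fs.subspace L'" "L' \<subseteq> supported (I2 m)" "card L' \<le> card L"
    "card (wedge_pairs m L) \<le> card (wedge_pairs m L')" and cl: "\<And>c x. c \<in> {1..n} \<Longrightarrow> x \<in> L' \<Longrightarrow> star_part c x \<in> L'"
    by auto
  define D where "D = degenerate (Suc n) L'"
  have fin: "finite L'" using L'(2) finite_supported[OF finite_I2] finite_subset by blast
  have "star_part d z \<in> D" if d: "d \<in> {1..Suc n}" and z: "z \<in> D" for d z
  proof -
    obtain x y where xy: "z = star_part (Suc n) x + y" "x \<in> L'" "y \<in> L'" "star_part (Suc n) y = 0"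
      using z unfolding D_def by (rule degenerateE)
    show ?thesis
    proof (cases "d = Suc n")
      case True
      have "star_part d z = star_part (Suc n) x + 0"
        unfolding xy(1) True star_part_add xy(4) star_part_idem ..
      then show ?thesis
        using degenerateI[OF xy(2) fs.subspace_0[OF L'(1)] star_part_0] by (simp add: D_def)
    next
      case False
      then have d: "d \<in> {1..n}" using that by auto
      have "star_part d z = star_part (Suc n) (star_part d x) + star_part d y"
        unfolding xy(1) star_part_add by (simp add: star_part_commute)
      moreover have "star_part (Suc n) (star_part d y) = 0"
        using xy(4) by (simp add: star_part_commute[of "Suc n"])
      ultimately show ?thesis
        using degenerateI[OF cl[OF d xy(2)] cl[OF d xy(3)]] by (simp add: D_def)
    qed
  qed
  moreover have "card (wedge_pairs m L') \<le> card (wedge_pairs m D)"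
    unfolding D_def using Suc.prems by (intro card_wedge_pairs_degenerate L') simp
  moreover have "card D \<le> card L'" unfolding D_def by (rule card_degenerate_le[OF L'(1) fin])
  ultimately show ?case
    using L' subspace_degenerate[OF L'(1), of "Suc n"] degenerate_subset_supported[OF L'(2), of "Suc n"]
    unfolding D_def[symmetric] by (intro exI[of _ D]) (auto intro: order_trans)
qed

text \<open>The stars at \<open>a\<close> and \<open>b\<close> share only the edge
  \<open>ab\<close>, so two star parts isolate each term of \<open>x\<close> and place its basis
  vector in \<open>L\<close>.\<close>

lemma coordinate_subspace_if_star_closed:
  fixes L :: "(nat \<times> nat \<Rightarrow> 'a::field) set"
  assumes L: "fs.subspace L" "L \<subseteq> supported (I2 m)"
    and cl: "\<And>c x. c \<in> {1..m} \<Longrightarrow> x \<in> L \<Longrightarrow> star_part c x \<in> L"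
  shows "\<exists>G \<subseteq> I2 m. L = supported G"
proof (intro exI conjI)
  let ?G = "{\<beta> \<in> I2 m. unit_vec \<beta> \<in> L}"
  show "?G \<subseteq> I2 m" by blast
  then have fin: "finite ?G" using finite_I2 finite_subset by blast
  show "L = supported ?G"
  proof
    show "supported ?G \<subseteq> L"
      unfolding span_unit_vec[OF fin, symmetric] by (rule fs.span_minimal[OF _ L(1)]) blast
    show "L \<subseteq> supported ?G"
    proof
      fix x assume x: "x \<in> L"
      have "unit_vec \<beta> \<in> L" if "x \<beta> \<noteq> 0" for \<beta>
      proof -
        have \<beta>: "\<beta> \<in> I2 m" using supportedD subsetD[OF L(2) x] that by metis
        obtain a b where ab: "\<beta> = (a, b)" by (cases \<beta>)
        have I: "a \<in> {1..m}" "b \<in> {1..m}" "a < b" using \<beta> ab by (auto simp: I2_def)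
        \<comment> \<open>The double star part keeps the positions \<open>(a, b)\<close> and
          \<open>(b, a)\<close>; the second lies outside \<open>I2 m\<close>.\<close>
        have sup: "x (b, a) = 0" using supportedD[OF subsetD[OF L(2) x]] I by (simp add: I2_def)
        have "star_part a (star_part b x) = fun_scale (x \<beta>) (unit_vec \<beta>)"
        proof
          fix \<gamma> :: "nat \<times> nat"
          obtain a' b' where g: "\<gamma> = (a', b')" by (cases \<gamma>)
          show "star_part a (star_part b x) \<gamma> = fun_scale (x \<beta>) (unit_vec \<beta>) \<gamma>"
            using I sup unfolding g ab by (auto simp: star_part_def fun_scale_apply unit_vec_def)
        qed
        moreover have "star_part a (star_part b x) \<in> L" using cl I x by blast
        ultimately have "fun_scale (inverse (x \<beta>)) (fun_scale (x \<beta>) (unit_vec \<beta>)) \<in> L"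
          using fs.subspace_scale[OF L(1)] by metis
        then show ?thesis using that by simp
      qed
      then show "x \<in> supported ?G"
        using supportedD[OF subsetD[OF L(2) x]] by (intro supportedI) blast
    qed
  qed
qed

lemma exists_coordinate_subspace:
  fixes L :: "(nat \<times> nat \<Rightarrow> 'a::{field,finite}) set"
  assumes L: "fs.subspace L" "L \<subseteq> supported (I2 m)" "card L \<le> CARD('a) ^ K" and K: "K \<le> m choose 2"
  shows "\<exists>G. G \<subseteq> I2 m \<and> card G = K \<and>
    card (wedge_pairs m L) \<le> card (wedge_pairs m (supported G :: (nat \<times> nat \<Rightarrow> 'a) set))"
proof -
  obtain L' :: "(nat \<times> nat \<Rightarrow> 'a) set" where L': "fs.subspace L'" "L' \<subseteq> supported (I2 m)" "card L' \<le> card L"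
    "card (wedge_pairs m L) \<le> card (wedge_pairs m L')" "\<forall>c\<in>{1..m}. \<forall>x\<in>L'. star_part c x \<in> L'"
    using degenerate_star_closed[OF L(1,2) order_refl] by blast
  obtain G where G: "G \<subseteq> I2 m" "L' = supported G"
    using coordinate_subspace_if_star_closed[OF L'(1,2)] L'(5) by blast
  have fG: "finite G" using G finite_subset finite_I2 by blast
  have "CARD('a) ^ card G = card L'"
    using card_subspace[OF fG, of L'] G L'(1) dim_supported[OF fG, where 'a='a] by simp
  then have "CARD('a) ^ card G \<le> CARD('a) ^ K" using L'(3) L(3) by simp
  then have "card G \<le> K" using card_field_gt_1[where 'a='a] by simp
  \<comment> \<open>Adding edges only enlarges the set of pairs, so the size may be raised to
    exactly \<open>K\<close>.\<close>
  then obtain G' where G': "G \<subseteq> G'" "G' \<subseteq> I2 m" "card G' = K"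
    using exists_subset_between[OF _ _ G(1) finite_I2, of K] K by (auto simp: card_I2)
  have "(supported G :: (nat \<times> nat \<Rightarrow> 'a) set) \<subseteq> supported G'" using G' by (auto simp: supported_def)
  then have "card (wedge_pairs m L') \<le> card (wedge_pairs m (supported G' :: (nat \<times> nat \<Rightarrow> 'a) set))"
    unfolding G(2) by (intro card_mono wedge_pairs_mono) simp
  then show ?thesis using G' L'(4) by (intro exI[of _ G']) simp
qed

section \<open>Compression to down-sets\<close>

definition edge :: "nat \<Rightarrow> nat \<Rightarrow> nat \<times> nat" where
  "edge a b = (min a b, max a b)"

lemma edge_commute: "edge a b = edge b a"
  by (simp add: edge_def min.commute max.commute)

lemma edge_eq_iff: "edge a b = edge c d \<longleftrightarrow> a = c \<and> b = d \<or> a = d \<and> b = c"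
  by (auto simp: edge_def min_def max_def split: if_splits)

lemma edge_in_I2: "edge a b \<in> I2 m \<longleftrightarrow> a \<in> {1..m} \<and> b \<in> {1..m} \<and> a \<noteq> b"
  by (auto simp: edge_def I2_def min_def max_def)

section \<open>Parallel points in a plane\<close>

definition par :: "'a::field \<times> 'a \<Rightarrow> 'a \<times> 'a \<Rightarrow> bool" where
  "par p q \<longleftrightarrow> fst p * snd q = fst q * snd p"

text \<open>The orthogonal space for the determinant form on \<open>F^2\<close>: the whole plane, a
  line, or 0.\<close>

definition perp :: "('a::field \<times> 'a) set \<Rightarrow> ('a \<times> 'a) set" where
  "perp S = {p. \<forall>q\<in>S. par p q}"

lemma par_commute: "par p q \<longleftrightarrow> par q p"
  by (auto simp: par_def)

text \<open>The origin is parallel to everything, hence the condition on \<open>r\<close>. Both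
  coordinates of \<open>r\<close> annihilate the determinant of \<open>p\<close> and
  \<open>z\<close>, and one of them is nonzero.\<close>

lemma par_trans:
  assumes "par p r" "par r z" "r \<noteq> (0, 0)"
  shows "par p z"
proof -
  obtain p1 p2 r1 r2 z1 z2 where e: "p = (p1, p2)" "r = (r1, r2)" "z = (z1, z2)"
    by (metis prod.exhaust)
  have h: "p1 * r2 = r1 * p2" "r1 * z2 = z1 * r2" using assms by (auto simp: par_def e)
  have "r1 * (p1 * z2 - z1 * p2) = p1 * (r1 * z2) - z1 * (r1 * p2)" by (simp add: algebra_simps)
  also have "\<dots> = 0" unfolding h(2) h(1)[symmetric] by (simp add: algebra_simps)
  finally have 1: "r1 * (p1 * z2 - z1 * p2) = 0" .
  have "r2 * (p1 * z2 - z1 * p2) = (p1 * r2) * z2 - p2 * (z1 * r2)" by (simp add: algebra_simps)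
  also have "\<dots> = 0" unfolding h(2)[symmetric] h(1) by (simp add: algebra_simps)
  finally have "r2 * (p1 * z2 - z1 * p2) = 0" .
  with 1 have "p1 * z2 - z1 * p2 = 0" using assms(3) e by auto
  then show ?thesis by (simp add: par_def e)
qed

text \<open>Neither space is the whole plane, since it would then contain the other. A common
  nonzero \<open>z\<close> would make both equal to the line through \<open>z\<close>.\<close>

lemma perp_incomparable:
  assumes "\<not> perp S \<subseteq> perp T" "\<not> perp T \<subseteq> perp S" "z \<in> perp S" "z \<in> perp T"
  shows "z = (0, 0)"
proof (rule ccontr)
  assume z: "z \<noteq> (0, 0)"
  have "perp S = {p. par p z}" if S: "\<not> perp T \<subseteq> perp S" "z \<in> perp S" for S T :: "('a \<times> 'a) set"
  proof -
    have "\<exists>r\<in>S. r \<noteq> (0, 0)"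
    proof (rule ccontr)
      assume "\<not> (\<exists>r\<in>S. r \<noteq> (0, 0))"
      then have "par p q" if "q \<in> S" for p q using that by (auto simp: par_def)
      then show False using S(1) by (auto simp: perp_def)
    qed
    then obtain r where r: "r \<in> S" "r \<noteq> (0, 0)" by blast
    have zS: "par q z" if "q \<in> S" for q using S(2) that par_commute[of q z] by (simp add: perp_def)
    show ?thesis
    proof (intro equalityI subsetI)
      fix p assume "p \<in> perp S"
      then have "par p r" using r by (simp add: perp_def)
      then show "p \<in> {p. par p z}" using par_trans[OF _ zS[OF r(1)] r(2)] by simp
    next
      fix p assume "p \<in> {p. par p z}"
      then have "par p q" if "q \<in> S" for q
        using par_trans[of p z q] zS[OF that] par_commute[of q z] z by simp
      then show "p \<in> perp S" by (simp add: perp_def)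
    qed
  qed
  from this[OF assms(2,3)] this[OF assms(1,4)] show False using assms(1) by simp
qed

text \<open>A pair of vectors is read as a family of points of \<open>F\<^sup>2\<close> over the vertices \<open>1, \<dots>, m\<close> of the
  graph \<open>G\<close>; its wedge is supported on \<open>G\<close> iff non-adjacent vertices carry parallel points.\<close>

definition point :: "(nat \<Rightarrow> 'a) \<times> (nat \<Rightarrow> 'a) \<Rightarrow> nat \<Rightarrow> 'a \<times> 'a" where
  "point p k = (fst p k, snd p k)"

lemma wedge_pairs_supported_iff:
  assumes "G \<subseteq> I2 m"
  shows "p \<in> wedge_pairs m (supported G) \<longleftrightarrow> fst p \<in> flag m \<and> snd p \<in> flag m \<and>
    (\<forall>a\<in>{1..m}. \<forall>b\<in>{1..m}. a \<noteq> b \<longrightarrow> edge a b \<notin> G \<longrightarrow> par (point p a) (point p b))"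
proof -
  obtain u v where p: "p = (u, v)" by (cases p)
  have "wedge m u v \<in> supported G \<longleftrightarrow> (\<forall>a\<in>{1..m}. \<forall>b\<in>{1..m}. a \<noteq> b \<longrightarrow> edge a b \<notin> G \<longrightarrow> u a * v b = u b * v a)"
    (is "?L \<longleftrightarrow> ?R")
  proof
    assume L: ?L
    show ?R
    proof (intro ballI impI)
      fix a b assume ab: "a \<in> {1..m}" "b \<in> {1..m}" "a \<noteq> b" "edge a b \<notin> G"
      have 0: "wedge m u v (edge a b) = 0" by (rule supportedD[OF L ab(4)])
      have "edge a b \<in> I2 m" using ab edge_in_I2 by blast
      then show "u a * v b = u b * v a"
        using 0 ab(3) by (cases a b rule: linorder_cases) (auto simp: wedge_def edge_def min_def max_def)
    qed
  next
    assume R: ?R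
    show ?L
    proof (rule supportedI)
      fix \<beta> assume \<beta>: "\<beta> \<notin> G"
      obtain a b where ab: "\<beta> = (a, b)" by (cases \<beta>)
      show "wedge m u v \<beta> = 0"
      proof (cases "\<beta> \<in> I2 m")
        case True
        then have "edge a b = \<beta>" "a \<in> {1..m}" "b \<in> {1..m}" "a \<noteq> b"
          using ab by (auto simp: I2_def edge_def)
        then have "u a * v b = u b * v a" using R \<beta> by blast
        then show ?thesis by (simp add: wedge_def ab)
      qed (simp add: wedge_def ab)
    qed
  qed
  then show ?thesis by (auto simp: p wedge_pairs_def par_def point_def)
qed

text \<open>Separates the conditions that involve the vertices \<open>i\<close> and \<open>j\<close>
  from those that compression leaves alone.\<close>

lemma ball_insert2_symmetric:
  assumes "\<And>a b. Q a b \<Longrightarrow> Q b a" "i \<notin> K" "j \<notin> K" "i \<noteq> j"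
  shows "(\<forall>a\<in>insert i (insert j K). \<forall>b\<in>insert i (insert j K). a \<noteq> b \<longrightarrow> Q a b) \<longleftrightarrow>
    (\<forall>a\<in>K. \<forall>b\<in>K. a \<noteq> b \<longrightarrow> Q a b) \<and> (\<forall>k\<in>K. Q i k) \<and> (\<forall>k\<in>K. Q j k) \<and> Q i j"
    (is "?L \<longleftrightarrow> ?R")
proof
  assume L: ?L
  have "Q i k" "Q j k" if "k \<in> K" for k using L that assms(2,3) by auto
  moreover have "Q i j" using L assms(4) by simp
  moreover have "\<forall>a\<in>K. \<forall>b\<in>K. a \<noteq> b \<longrightarrow> Q a b" using L by simp
  ultimately show ?R by blast
next
  assume R: ?R
  show ?L
  proof (intro ballI impI)
    fix a b assume "a \<in> insert i (insert j K)" "b \<in> insert i (insert j K)" "a \<noteq> b"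
    then show "Q a b" using R assms(1)[of b a] by (elim insertE) simp_all
  qed
qed

section \<open>Compression of a graph from \<open>j\<close> towards \<open>i\<close>\<close>

definition moved :: "nat \<Rightarrow> nat \<Rightarrow> nat \<Rightarrow> (nat \<times> nat) set \<Rightarrow> nat set" where
  "moved m i j G = {k \<in> {1..m} - {i, j}. edge j k \<in> G \<and> edge i k \<notin> G}"

text \<open>Known in graph theory as the Kelmans transformation. The edge \<open>ij\<close> itself
  stays where it is.\<close>

definition compress :: "nat \<Rightarrow> nat \<Rightarrow> nat \<Rightarrow> (nat \<times> nat) set \<Rightarrow> (nat \<times> nat) set" where
  "compress m i j G = (G - edge j ` moved m i j G) \<union> edge i ` moved m i j G"

lemma inj_on_edge: "inj_on (edge a) S"
  by (auto simp: inj_on_def edge_eq_iff)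

context
  fixes m i j :: nat and G :: "(nat \<times> nat) set"
  assumes ij: "i < j" "i \<in> {1..m}" "j \<in> {1..m}" and G: "G \<subseteq> I2 m"
begin

private lemma finite_moved: "finite (moved m i j G)"
  by (simp add: moved_def)

private lemma finite_G: "finite G"
  using G finite_I2 finite_subset by blast

private lemma moved_in: "edge j ` moved m i j G \<subseteq> G"
  by (auto simp: moved_def)

private lemma moved_out: "edge i ` moved m i j G \<inter> G = {}"
  by (auto simp: moved_def)

lemma compress_subset: "compress m i j G \<subseteq> I2 m"
proof -
  have "edge i k \<in> I2 m" if "k \<in> moved m i j G" for k
    unfolding edge_in_I2 using that ij by (auto simp: moved_def)
  then show ?thesis using G by (auto simp: compress_def)
qed

text \<open>Stated without subtraction on naturals. The constant weight 1 shows that the number of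
  edges is kept; the sum of endpoints gives the termination measure.\<close>

lemma sum_compress:
  fixes f :: "nat \<times> nat \<Rightarrow> nat"
  shows "sum f (compress m i j G) + (\<Sum>k\<in>moved m i j G. f (edge j k))
    = sum f G + (\<Sum>k\<in>moved m i j G. f (edge i k))"
proof -
  have "sum f (compress m i j G) = sum f (G - edge j ` moved m i j G) + sum f (edge i ` moved m i j G)"
    unfolding compress_def using moved_out finite_G finite_moved by (intro sum.union_disjoint) auto
  moreover have "sum f (edge a ` moved m i j G) = (\<Sum>k\<in>moved m i j G. f (edge a k))" for a
    by (rule sum.reindex_cong[OF inj_on_edge refl]) simp
  moreover have "sum f (G - edge j ` moved m i j G) + sum f (edge j ` moved m i j G) = sum f G"
    using sum.subset_diff[OF moved_in finite_G, of f] by simp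
  ultimately show ?thesis by simp
qed

lemma card_compress: "card (compress m i j G) = card G"
  using sum_compress[of "\<lambda>_. 1"] by simp

text \<open>Apart from the edge \<open>ij\<close>, vertex \<open>i\<close> receives the union of the
  two neighbourhoods and \<open>j\<close> their intersection. For non-neighbours, which impose the
  conditions, the roles are exchanged.\<close>

lemma compress_i_iff:
  assumes "k \<in> {1..m}" "k \<noteq> i" "k \<noteq> j"
  shows "edge i k \<in> compress m i j G \<longleftrightarrow> edge i k \<in> G \<or> edge j k \<in> G"
  using assms ij by (auto simp: compress_def moved_def edge_eq_iff)

lemma compress_j_iff:
  assumes "k \<in> {1..m}" "k \<noteq> i" "k \<noteq> j"
  shows "edge j k \<in> compress m i j G \<longleftrightarrow> edge i k \<in> G \<and> edge j k \<in> G"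
  using assms ij by (auto simp: compress_def moved_def edge_eq_iff)

lemma compress_other_iff:
  assumes "a \<notin> {i, j} \<and> b \<notin> {i, j} \<or> {a, b} = {i, j}"
  shows "edge a b \<in> compress m i j G \<longleftrightarrow> edge a b \<in> G"
  using assms ij by (auto simp: compress_def moved_def edge_eq_iff doubleton_eq_iff)

text \<open>The points at \<open>i\<close> and \<open>j\<close> range over subspaces \<open>A\<close> and \<open>B\<close> of \<open>F\<^sup>2\<close> cut out by the points at
  the other indices; after compression they range over a space containing \<open>A + B\<close> and over \<open>A \<inter> B\<close>.\<close>

lemma card_wedge_pairs_compress:
  "card (wedge_pairs m (supported G :: (nat \<times> nat \<Rightarrow> 'a::{field,finite}) set))
    \<le> card (wedge_pairs m (supported (compress m i j G) :: (nat \<times> nat \<Rightarrow> 'a) set))"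
proof -
  define K where "K = {1..m} - {i, j}"
  \<comment> \<open>The subspace to which the points over \<open>K\<close> confine a point at vertex
    \<open>a\<close>, for \<open>a\<close> equal to \<open>i\<close> or \<open>j\<close>.\<close>
  define A where "A = (\<lambda>(p :: (nat \<Rightarrow> 'a) \<times> (nat \<Rightarrow> 'a)) a. perp (point p ` {k \<in> K. edge a k \<notin> G}))"
  define R where "R = (\<lambda>p :: (nat \<Rightarrow> 'a) \<times> (nat \<Rightarrow> 'a). fst p \<in> flag m \<and> snd p \<in> flag m \<and>
    (\<forall>a\<in>K. \<forall>b\<in>K. a \<noteq> b \<longrightarrow> edge a b \<notin> G \<longrightarrow> par (point p a) (point p b)))"
  have m: "{1..m} = insert i (insert j K)" using ij by (auto simp: K_def)
  have nK: "i \<notin> K" "j \<notin> K" "i \<noteq> j" using ij by (auto simp: K_def)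
  have A_iff: "x \<in> A p a \<longleftrightarrow> (\<forall>k\<in>K. edge a k \<notin> G \<longrightarrow> par x (point p k))" for x p a
    by (auto simp: A_def perp_def)
  have split: "p \<in> wedge_pairs m (supported H) \<longleftrightarrow>
      fst p \<in> flag m \<and> snd p \<in> flag m \<and>
      (\<forall>a\<in>K. \<forall>b\<in>K. a \<noteq> b \<longrightarrow> edge a b \<notin> H \<longrightarrow> par (point p a) (point p b)) \<and>
      (\<forall>k\<in>K. edge i k \<notin> H \<longrightarrow> par (point p i) (point p k)) \<and>
      (\<forall>k\<in>K. edge j k \<notin> H \<longrightarrow> par (point p j) (point p k)) \<and>
      (edge i j \<notin> H \<longrightarrow> par (point p i) (point p j))"
    if "H \<subseteq> I2 m" for H and p :: "(nat \<Rightarrow> 'a) \<times> (nat \<Rightarrow> 'a)"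
  proof -
    define Q where "Q = (\<lambda>a b. edge a b \<notin> H \<longrightarrow> par (point p a) (point p b))"
    have "Q a b \<Longrightarrow> Q b a" for a b
      unfolding Q_def using edge_commute[of a b] par_commute[of "point p a" "point p b"] by simp
    note * = ball_insert2_symmetric[of Q, OF this nK]
    show ?thesis
      unfolding wedge_pairs_supported_iff[OF that] m using * unfolding Q_def by simp
  qed
  have old: "p \<in> wedge_pairs m (supported G) \<longleftrightarrow> R p \<and> point p i \<in> A p i \<and> point p j \<in> A p j \<and>
      (edge i j \<notin> G \<longrightarrow> par (point p i) (point p j))" for p
    unfolding split[OF G] R_def A_iff by blast
  have new: "p \<in> wedge_pairs m (supported (compress m i j G)) \<longleftrightarrow> R p \<and>
      (\<forall>k\<in>K. edge i k \<notin> G \<and> edge j k \<notin> G \<longrightarrow> par (point p i) (point p k)) \<and>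
      point p j \<in> A p i \<inter> A p j \<and> (edge i j \<notin> G \<longrightarrow> par (point p i) (point p j))" for p
  proof -
    have c: "edge i k \<in> compress m i j G \<longleftrightarrow> edge i k \<in> G \<or> edge j k \<in> G"
      "edge j k \<in> compress m i j G \<longleftrightarrow> edge i k \<in> G \<and> edge j k \<in> G" if "k \<in> K" for k
      using that compress_i_iff compress_j_iff by (auto simp: K_def)
    have o: "edge a b \<in> compress m i j G \<longleftrightarrow> edge a b \<in> G" if "a \<in> K" "b \<in> K" for a b
      using that by (intro compress_other_iff) (auto simp: K_def)
    have oij: "edge i j \<in> compress m i j G \<longleftrightarrow> edge i j \<in> G"
      by (rule compress_other_iff) simp
    show ?thesis
      unfolding split[OF compress_subset] R_def A_iff Int_iff using c o oij by blast
  qed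
  \<comment> \<open>The point at \<open>j\<close> must end in the intersection of both spaces. If
    they are nested, keeping or swapping the two points achieves this. Otherwise the intersection is
    0, so \<open>j\<close> receives 0 and \<open>i\<close> the sum, from which both summands can be
    read off.\<close>
  define F where "F = (\<lambda>p. if A p j \<subseteq> A p i then p
    else if A p i \<subseteq> A p j
      then ((fst p)(i := fst p j, j := fst p i), (snd p)(i := snd p j, j := snd p i))
    else ((fst p)(i := fst p i + fst p j, j := 0), (snd p)(i := snd p i + snd p j, j := 0)))"
  have F_K: "point (F p) k = point p k" if "k \<in> K" for p k
    using that nK by (auto simp: F_def point_def)
  \<comment> \<open>\<open>F\<close> leaves the points over \<open>K\<close> alone, so the spaces,
    and with them the case used, can be recovered from \<open>F p\<close>.\<close>
  have A_F: "A (F p) a = A p a" for p a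
    unfolding set_eq_iff A_iff using F_K by simp
  have upd_flag: "f(a := x) \<in> flag m" if "f \<in> flag m" "a \<in> {1..m}" for f :: "nat \<Rightarrow> 'a" and a x
    using that by (auto simp: flag_eq_supported supported_def)
  have R_F: "R (F p)" if "R p" for p
  proof -
    have "fst (F p) \<in> flag m" "snd (F p) \<in> flag m"
      using that ij by (auto simp: F_def R_def intro!: upd_flag)
    then show ?thesis using that F_K unfolding R_def by simp
  qed
  have FG: "F p \<in> wedge_pairs m (supported (compress m i j G))"
    if p: "p \<in> wedge_pairs m (supported G)" for p
  proof -
    have p': "R p" "point p i \<in> A p i" "point p j \<in> A p j" "edge i j \<notin> G \<Longrightarrow> par (point p i) (point p j)"
      using p old by auto
    have "(\<forall>k\<in>K. edge i k \<notin> G \<and> edge j k \<notin> G \<longrightarrow> par (point (F p) i) (point p k)) \<and>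
      point (F p) j \<in> A p i \<inter> A p j \<and> (edge i j \<notin> G \<longrightarrow> par (point (F p) i) (point (F p) j))"
    proof (cases "A p j \<subseteq> A p i")
      case True
      then have "F p = p" by (simp add: F_def)
      moreover have "point p j \<in> A p i" using True p'(3) by blast
      ultimately show ?thesis using p'(2-4) A_iff[of "point p i" p i] by simp
    next
      case nji: False
      show ?thesis
      proof (cases "A p i \<subseteq> A p j")
        case True
        then have "point (F p) i = point p j" "point (F p) j = point p i"
          using nji nK by (auto simp: F_def point_def)
        then show ?thesis using p' True A_iff par_commute by (metis Int_iff subsetD)
      next
        case False
        then have F1: "point (F p) i = (fst p i + fst p j, snd p i + snd p j)" and F2: "point (F p) j = (0, 0)"
          using nji nK by (auto simp: F_def point_def)
        have "par (point (F p) i) (point p k)" if "k \<in> K" "edge i k \<notin> G" "edge j k \<notin> G" for k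
        proof -
          have "par (point p i) (point p k)" "par (point p j) (point p k)" using p' that A_iff by blast+
          then show ?thesis unfolding F1 by (simp add: par_def point_def algebra_simps)
        qed
        moreover have "point (F p) j \<in> A p i \<inter> A p j" unfolding F2 by (simp add: A_iff par_def)
        moreover have "par (point (F p) i) (point (F p) j)" unfolding F2 by (simp add: par_def)
        ultimately show ?thesis by blast
      qed
    qed
    then show ?thesis unfolding new A_F using R_F[OF p'(1)] F_K by simp
  qed
  have inj: "p = p'" if pp: "p \<in> wedge_pairs m (supported G)" "p' \<in> wedge_pairs m (supported G)"
    and eq: "F p = F p'" for p p'
  proof -
    have A: "A p a = A p' a" for a using A_F[of p a] A_F[of p' a] eq by simp
    have mem: "point p i \<in> A p i" "point p j \<in> A p j" "point p' i \<in> A p i" "point p' j \<in> A p j"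
      using pp old A by auto
    have fl: "R p" "R p'" using pp old by auto
    have off: "fst p k = fst p' k \<and> snd p k = snd p' k" if "k \<noteq> i" "k \<noteq> j" for k
    proof (cases "k \<in> K")
      case True
      then have "point p k = point p' k" using F_K eq by metis
      then show ?thesis by (simp add: point_def)
    next
      case False
      then have "k \<notin> {1..m}" using that m by blast
      then show ?thesis using fl supportedD unfolding R_def flag_eq_supported by metis
    qed
    have ij_eq: "point p i = point p' i \<and> point p j = point p' j"
    proof (cases "A p j \<subseteq> A p i")
      case True
      then show ?thesis using eq A by (simp add: F_def)
    next
      case nji: False
      show ?thesis
      proof (cases "A p i \<subseteq> A p j")
        case True
        have "point (F p) i = point p j" "point (F p) j = point p i"
          using True nji nK by (auto simp: F_def point_def)
        moreover have "point (F p') i = point p' j" "point (F p') j = point p' i"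
          using True nji nK A by (auto simp: F_def point_def)
        ultimately show ?thesis using eq by simp
      next
        case False
        have "point (F p) i = (fst p i + fst p j, snd p i + snd p j)"
          using False nji nK by (auto simp: F_def point_def)
        moreover have "point (F p') i = (fst p' i + fst p' j, snd p' i + snd p' j)"
          using False nji nK A by (auto simp: F_def point_def)
        ultimately have s: "fst p i + fst p j = fst p' i + fst p' j" "snd p i + snd p j = snd p' i + snd p' j"
          using eq by simp_all
        \<comment> \<open>Equal sums make the change at \<open>i\<close> the negative of the change
          at \<open>j\<close>, so it lies in both spaces and must vanish.\<close>
        let ?z = "(fst p i - fst p' i, snd p i - snd p' i)"
        have z: "?z = (fst p' j - fst p j, snd p' j - snd p j)"
          using s by (simp add: algebra_simps)
        have diff: "(fst x - fst y, snd x - snd y) \<in> A p a" if "x \<in> A p a" "y \<in> A p a" for x y a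
          using that unfolding A_iff by (simp add: par_def algebra_simps)
        have "?z \<in> A p i" using diff[OF mem(1) mem(3)] by (simp add: point_def)
        moreover have "?z \<in> A p j" unfolding z using diff[OF mem(4) mem(2)] by (simp add: point_def)
        ultimately have "?z = (0, 0)"
          using False nji unfolding A_def by (intro perp_incomparable)
        then show ?thesis using s by (simp add: point_def)
      qed
    qed
    have "fst p k = fst p' k \<and> snd p k = snd p' k" for k
      using off[of k] ij_eq by (cases "k = i \<or> k = j") (auto simp: point_def)
    then show ?thesis by (simp add: prod_eq_iff fun_eq_iff)
  qed
  show ?thesis
    by (rule card_inj_on_le[of F]) (use inj FG in \<open>auto intro: inj_onI\<close>)
qed

end

lemma downset_if_compressed:
  assumes G: "G \<subseteq> I2 m"
    and cl: "\<And>i j k. i < j \<Longrightarrow> i \<in> {1..m} \<Longrightarrow> k \<noteq> i \<Longrightarrow> edge j k \<in> G \<Longrightarrow> edge i k \<in> G"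
  shows "downset m G"
proof -
  have shift: "edge i k \<in> G" if "i \<le> j" "i \<in> {1..m}" "k \<noteq> i" "edge j k \<in> G" for i j k
    using that cl[of i j k] by (cases "i = j") auto
  have "(c, d) \<in> G" if ab: "(a, b) \<in> G" and cd: "(c, d) \<in> I2 m" "c \<le> a" "d \<le> b" for a b c d
  proof -
    have ord: "a < b" "c < d" "1 \<le> c" "d \<le> m" using ab G cd by (auto simp: I2_def)
    have "edge a b \<in> G" using ab ord by (simp add: edge_def)
    \<comment> \<open>The endpoints are lowered one at a time, from \<open>ab\<close> to
      \<open>cb\<close> to \<open>cd\<close>. The intermediate edge is not a loop because
      \<open>c < d \<le> b\<close>.\<close>
    then have "edge c b \<in> G" using shift[of c a b] ord cd by simp
    then have "edge b c \<in> G" by (simp add: edge_commute)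
    then have "edge d c \<in> G" using shift[of d b c] ord cd by simp
    then show ?thesis using ord by (simp add: edge_def)
  qed
  then show ?thesis using G unfolding downset_def by blast
qed

text \<open>Compression at a violation of the down-set condition moves at least one edge, and each
  moved edge loses \<open>j - i\<close> in its sum of endpoints; so the total over all edges
  decreases.\<close>

lemma exists_downset:
  assumes "G \<subseteq> I2 m"
  shows "\<exists>U. downset m U \<and> card U = card G \<and>
    card (wedge_pairs m (supported G :: (nat \<times> nat \<Rightarrow> 'a::{field,finite}) set))
      \<le> card (wedge_pairs m (supported U :: (nat \<times> nat \<Rightarrow> 'a) set))"
  using assms
proof (induction "\<Sum>\<beta>\<in>G. fst \<beta> + snd \<beta>" arbitrary: G rule: less_induct)
  case less
  show ?case
  proof (cases "downset m G")
    case True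
    then show ?thesis by blast
  next
    case False
    then obtain i j k where k: "i < j" "i \<in> {1..m}" "k \<noteq> i" "edge j k \<in> G" "edge i k \<notin> G"
      using downset_if_compressed[OF less.prems] by blast
    have jk: "j \<in> {1..m}" "k \<in> {1..m}" "j \<noteq> k" using less.prems k(4) edge_in_I2 by blast+
    let ?G = "compress m i j G"
    have km: "k \<in> moved m i j G" using k jk by (simp add: moved_def)
    have "(\<Sum>k\<in>moved m i j G. fst (edge i k) + snd (edge i k)) < (\<Sum>k\<in>moved m i j G. fst (edge j k) + snd (edge j k))"
    proof (rule sum_strict_mono)
      show "finite (moved m i j G)" by (simp add: moved_def)
      show "moved m i j G \<noteq> {}" using km by blast
      fix l show "fst (edge i l) + snd (edge i l) < fst (edge j l) + snd (edge j l)"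
        using k(1) by (simp add: edge_def min_def max_def)
    qed
    then have "(\<Sum>\<beta>\<in>?G. fst \<beta> + snd \<beta>) < (\<Sum>\<beta>\<in>G. fst \<beta> + snd \<beta>)"
      using sum_compress[OF k(1,2) jk(1) less.prems, of "\<lambda>\<beta>. fst \<beta> + snd \<beta>"] by linarith
    then obtain U where "downset m U" "card U = card ?G"
      "card (wedge_pairs m (supported ?G :: (nat \<times> nat \<Rightarrow> 'a) set))
      \<le> card (wedge_pairs m (supported U :: (nat \<times> nat \<Rightarrow> 'a) set))"
      using less.hyps[of ?G] compress_subset[OF k(1,2) jk(1) less.prems] by blast
    then show ?thesis
      using card_compress[OF k(1,2) jk(1) less.prems]
        card_wedge_pairs_compress[OF k(1,2) jk(1) less.prems, where 'a='a] by (intro exI[of _ U]) auto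
  qed
qed

section \<open>Higher weights of the code\<close>

text \<open>Each \<open>L\<close> is dominated by some down-set of size \<open>K\<close>. There are
  finitely many of these, so a best one dominates all \<open>L\<close> at once.\<close>

lemma exists_optimal_downset:
  assumes K: "K \<le> m choose 2"
  shows "\<exists>U. downset m U \<and> card U = K \<and>
    (\<forall>L :: (nat \<times> nat \<Rightarrow> 'a::{field,finite}) set. fs.subspace L \<longrightarrow> L \<subseteq> supported (I2 m) \<longrightarrow>
       card L \<le> CARD('a) ^ K \<longrightarrow> card (sections m L) \<le> card (sections m (supported U :: (nat \<times> nat \<Rightarrow> 'a) set)))"
proof -
  define N where "N = (\<lambda>U. card (sections m (supported U :: (nat \<times> nat \<Rightarrow> 'a) set)))"
  define \<U> where "\<U> = {U. downset m U \<and> card U = K}"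
  have dom: "\<exists>U\<in>\<U>. card (sections m L) \<le> N U"
    if L: "fs.subspace L" "L \<subseteq> supported (I2 m)" "card L \<le> CARD('a) ^ K" for L :: "(nat \<times> nat \<Rightarrow> 'a) set"
  proof -
    obtain G where G: "G \<subseteq> I2 m" "card G = K"
      "card (wedge_pairs m L) \<le> card (wedge_pairs m (supported G :: (nat \<times> nat \<Rightarrow> 'a) set))"
      using exists_coordinate_subspace[OF L K] by blast
    obtain U where U: "downset m U" "card U = card G"
      "card (wedge_pairs m (supported G :: (nat \<times> nat \<Rightarrow> 'a) set))
        \<le> card (wedge_pairs m (supported U :: (nat \<times> nat \<Rightarrow> 'a) set))"
      using exists_downset[OF G(1), where 'a='a] by blast
    have "card (sections m L) \<le> N U"
      unfolding N_def
      by (rule card_sections_mono[OF L(1) subspace_supported order_trans[OF G(3) U(3)]])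
    then show ?thesis using U G(2) by (auto simp: \<U>_def)
  qed
  have "finite \<U>"
  proof (rule finite_subset)
    show "\<U> \<subseteq> Pow (I2 m)" by (auto simp: \<U>_def downset_def)
  qed simp
  \<comment> \<open>Domination applied to the zero subspace already produces a down-set of size
    \<open>K\<close>.\<close>
  moreover have "\<U> \<noteq> {}"
  proof -
    have "fs.subspace {0 :: nat \<times> nat \<Rightarrow> 'a}" by (rule fs.subspace_single_0)
    moreover have "{0 :: nat \<times> nat \<Rightarrow> 'a} \<subseteq> supported (I2 m)"
      using fs.subspace_0[OF subspace_supported] by blast
    moreover have "card {0 :: nat \<times> nat \<Rightarrow> 'a} \<le> CARD('a) ^ K" by (simp add: Suc_le_eq)
    ultimately show ?thesis using dom[of "{0}"] by blast
  qed
  ultimately obtain U where U: "U \<in> \<U>" "\<And>U'. U' \<in> \<U> \<Longrightarrow> N U' \<le> N U"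
    using Max_in[of "N ` \<U>"] Max_ge[of "N ` \<U>"] by (metis (no_types, lifting) finite_imageI imageE image_is_empty imageI)
  have "card (sections m L) \<le> N U"
    if L: "fs.subspace L" "L \<subseteq> supported (I2 m)" "card L \<le> CARD('a) ^ K" for L :: "(nat \<times> nat \<Rightarrow> 'a) set"
  proof -
    obtain U' where "U' \<in> \<U>" "card (sections m L) \<le> N U'" using dom[OF L] by blast
    then show ?thesis using U(2)[of U'] by simp
  qed
  then show ?thesis using U(1) unfolding N_def \<U>_def by (intro exI[of _ U]) simp
qed

section \<open>Codewords as values of linear forms at the columns\<close>

definition encode :: "nat \<Rightarrow> (nat \<Rightarrow> nat \<times> nat \<Rightarrow> 'a::{field,finite}) \<Rightarrow> (nat \<times> nat \<Rightarrow> 'a) \<Rightarrow> nat \<Rightarrow> 'a" where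
  "encode m M \<phi> = (\<lambda>j. if j < grassmann_length TYPE('a) m then \<Sum>\<beta>\<in>I2 m. \<phi> \<beta> * M j \<beta> else 0)"

lemma encode_add: "encode m M (\<phi> + \<psi>) = encode m M \<phi> + encode m M \<psi>"
  by (auto simp: encode_def fun_eq_iff distrib_right sum.distrib)

lemma encode_diff: "encode m M (\<phi> - \<psi>) = encode m M \<phi> - encode m M \<psi>"
  by (auto simp: encode_def fun_eq_iff left_diff_distrib sum_subtractf)

lemma encode_scale: "encode m M (fun_scale k \<phi>) = fun_scale k (encode m M \<phi>)"
  by (auto simp: encode_def fun_eq_iff fun_scale_apply sum_distrib_left mult.assoc)

lemma subspace_encode_image:
  assumes "fs.subspace \<Phi>"
  shows "fs.subspace (encode m M ` \<Phi>)"
proof (rule fs.subspaceI)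
  have "encode m M 0 = 0" by (auto simp: encode_def fun_eq_iff)
  then show "0 \<in> encode m M ` \<Phi>" using fs.subspace_0[OF assms] by (metis imageI)
next
  fix x y assume "x \<in> encode m M ` \<Phi>" "y \<in> encode m M ` \<Phi>"
  then obtain \<phi> \<psi> where *: "\<phi> \<in> \<Phi>" "\<psi> \<in> \<Phi>" "x = encode m M \<phi>" "y = encode m M \<psi>" by blast
  show "x + y \<in> encode m M ` \<Phi>"
    unfolding *(3,4) encode_add[symmetric] by (intro imageI fs.subspace_add[OF assms] *)
next
  fix k x assume "x \<in> encode m M ` \<Phi>"
  then obtain \<phi> where *: "\<phi> \<in> \<Phi>" "x = encode m M \<phi>" by blast
  show "fun_scale k x \<in> encode m M ` \<Phi>"
    unfolding *(2) encode_scale[symmetric] by (intro imageI fs.subspace_scale[OF assms] *)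
qed

lemma encode_in_supported: "encode m (M :: nat \<Rightarrow> nat \<times> nat \<Rightarrow> 'a::{field,finite}) \<phi> \<in> supported {..<grassmann_length TYPE('a) m}"
  by (simp add: encode_def supported_def)

lemma grassmann_code_eq:
  fixes M :: "nat \<Rightarrow> nat \<times> nat \<Rightarrow> 'a::{field,finite}"
  shows "grassmann_code m M = encode m M ` supported (I2 m)"
proof
  have row: "(\<lambda>j. if j < grassmann_length TYPE('a) m then M j \<beta> else 0) = encode m M (unit_vec \<beta>)"
    if "\<beta> \<in> I2 m" for \<beta>
  proof -
    have "(\<Sum>\<gamma>\<in>I2 m. unit_vec \<beta> \<gamma> * M j \<gamma>) = (\<Sum>\<gamma>\<in>I2 m. if \<gamma> = \<beta> then M j \<beta> else 0)" for j
      by (rule sum.cong) (auto simp: unit_vec_def)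
    then show ?thesis using that by (simp add: encode_def cong: if_cong)
  qed
  show "grassmann_code m M \<subseteq> encode m M ` supported (I2 m)"
    unfolding grassmann_code_def
  proof (rule fs.span_minimal)
    show "fs.subspace (encode m M ` supported (I2 m))" by (rule subspace_encode_image) simp
    show "{\<lambda>j. if j < grassmann_length TYPE('a) m then M j \<beta> else 0 |\<beta>. \<beta> \<in> I2 m} \<subseteq> encode m M ` supported (I2 m)"
      using row by auto
  qed
  show "encode m M ` supported (I2 m) \<subseteq> grassmann_code m M"
  proof safe
    fix \<phi> :: "nat \<times> nat \<Rightarrow> 'a"
    have "encode m M \<phi> = (\<Sum>\<beta>\<in>I2 m. fun_scale (\<phi> \<beta>) (\<lambda>j. if j < grassmann_length TYPE('a) m then M j \<beta> else 0))"
      by (auto simp: encode_def fun_eq_iff sum_fun_apply fun_scale_apply)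
    also have "\<dots> \<in> grassmann_code m M"
      unfolding grassmann_code_def by (intro fs.span_sum fs.span_scale fs.span_base) blast
    finally show "encode m M \<phi> \<in> grassmann_code m M" .
  qed
qed

lemma wedge_unit_vec:
  assumes "(a, b) \<in> I2 m"
  shows "wedge m (unit_vec a) (unit_vec b) = unit_vec (a, b)"
  using assms by (auto simp: wedge_def unit_vec_def fun_eq_iff I2_def)

context
  fixes m :: nat and M :: "nat \<Rightarrow> nat \<times> nat \<Rightarrow> 'a::{field,finite}"
  assumes M: "grassmann_matrix m M"
begin

lemma columns_bij: "bij_betw (\<lambda>j. fs.span {M j}) {..<grassmann_length TYPE('a) m} (plucker m ` grassmannian m)"
  using M by (simp add: grassmann_matrix_def)

lemma column_in_supported:
  assumes "j < grassmann_length TYPE('a) m"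
  shows "M j \<in> supported (I2 m)"
proof -
  have "fs.span {M j} \<in> plucker m ` grassmannian m"
    using bij_betw_apply[OF columns_bij, of j] assms by simp
  then obtain W where "W \<in> grassmannian m" "fs.span {M j} = plucker m W" by blast
  moreover have "plucker m W \<subseteq> supported (I2 m)" for W :: "(nat \<Rightarrow> 'a) set"
    unfolding plucker_def by (rule fs.span_minimal) auto
  ultimately show ?thesis using fs.span_base[of "M j" "{M j}"] by blast
qed

text \<open>Membership in a subspace depends only on the line spanned by a column, so the choice of
  representatives does not matter.\<close>

lemma card_columns_in:
  assumes L: "fs.subspace L"
  shows "card {j \<in> {..<grassmann_length TYPE('a) m}. M j \<in> L} = card (sections m L)"
proof -
  have "bij_betw (\<lambda>j. fs.span {M j}) {j \<in> {..<grassmann_length TYPE('a) m}. M j \<in> L} (plucker m ` sections m L)"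
  proof (rule bij_betw_subset[OF columns_bij])
    show "(\<lambda>j. fs.span {M j}) ` {j \<in> {..<grassmann_length TYPE('a) m}. M j \<in> L} = plucker m ` sections m L"
    proof (intro equalityI subsetI)
      fix P assume "P \<in> (\<lambda>j. fs.span {M j}) ` {j \<in> {..<grassmann_length TYPE('a) m}. M j \<in> L}"
      then obtain j where j: "j < grassmann_length TYPE('a) m" "M j \<in> L" "P = fs.span {M j}" by auto
      then obtain W where W: "W \<in> grassmannian m" "P = plucker m W"
        using bij_betw_apply[OF columns_bij, of j] by auto
      have "plucker m W \<subseteq> L"
        unfolding W(2)[symmetric] j(3) span_singleton_subset_iff[OF L] by (rule j(2))
      then show "P \<in> plucker m ` sections m L" using W by (simp add: sections_def)
    next
      fix P assume "P \<in> plucker m ` sections m L"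
      then obtain W where W: "W \<in> grassmannian m" "plucker m W \<subseteq> L" "P = plucker m W"
        by (auto simp: sections_def)
      then have "P \<in> (\<lambda>j. fs.span {M j}) ` {..<grassmann_length TYPE('a) m}"
        unfolding bij_betw_imp_surj_on[OF columns_bij] by blast
      then obtain j where j: "j < grassmann_length TYPE('a) m" "fs.span {M j} = P" by blast
      have "M j \<in> L"
        unfolding span_singleton_subset_iff[OF L, symmetric] j(2) W(3) by (rule W(2))
      then show "P \<in> (\<lambda>j. fs.span {M j}) ` {j \<in> {..<grassmann_length TYPE('a) m}. M j \<in> L}"
        using j by (intro image_eqI[of _ _ j]) simp_all
    qed
  qed blast
  then have "card {j \<in> {..<grassmann_length TYPE('a) m}. M j \<in> L} = card (plucker m ` sections m L)"
    by (rule bij_betw_same_card)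
  also have "\<dots> = card (sections m L)"
    by (rule card_image) (rule inj_on_subset[OF inj_on_plucker], auto simp: sections_def)
  finally show ?thesis .
qed

text \<open>Each basis vector \<open>e_a \<and> e_b\<close> is itself a point of the Grassmannian,
  hence proportional to a column. A form that vanishes at all columns therefore vanishes on a
  basis.\<close>

lemma inj_on_encode: "inj_on (encode m M) (supported (I2 m))"
proof (rule inj_onI)
  fix \<phi> \<psi> assume pp: "\<phi> \<in> supported (I2 m)" "\<psi> \<in> supported (I2 m)" and eq: "encode m M \<phi> = encode m M \<psi>"
  have 0: "encode m M (\<phi> - \<psi>) = 0" unfolding encode_diff eq by simp
  have "(\<phi> - \<psi>) \<beta> = 0" if \<beta>: "\<beta> \<in> I2 m" for \<beta>
  proof -
    obtain a b where ab: "\<beta> = (a, b)" by (cases \<beta>)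
    have w: "wedge m (unit_vec a) (unit_vec b) = (unit_vec \<beta> :: _ \<Rightarrow> 'a)"
      using \<beta> unfolding ab by (rule wedge_unit_vec)
    have "unit_vec \<beta> \<noteq> (0 :: _ \<Rightarrow> 'a)" by (metis unit_vec_def zero_fun_apply zero_neq_one)
    moreover have "unit_vec a \<in> (flag m :: (nat \<Rightarrow> 'a) set)" "unit_vec b \<in> (flag m :: (nat \<Rightarrow> 'a) set)"
      using \<beta> ab by (auto simp: flag_eq_supported I2_def)
    ultimately have "fs.span {unit_vec a, unit_vec b} \<in> (grassmannian m :: (nat \<Rightarrow> 'a) set set)"
      using w by (intro span_pair_in_grassmannian) simp_all
    then have "plucker m (fs.span {unit_vec a, unit_vec b}) \<in> (\<lambda>j. fs.span {M j}) ` {..<grassmann_length TYPE('a) m}"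
      unfolding bij_betw_imp_surj_on[OF columns_bij] by (rule imageI)
    then obtain j where j: "j < grassmann_length TYPE('a) m" "fs.span {M j} = fs.span {unit_vec \<beta>}"
      unfolding plucker_span w by blast
    then have "unit_vec \<beta> \<in> fs.span {M j}" by (simp add: fs.span_base)
    then obtain d where d: "unit_vec \<beta> = fun_scale d (M j)" by (auto simp: fs.span_singleton)
    have "(\<phi> - \<psi>) \<beta> = (\<Sum>\<gamma>\<in>I2 m. if \<gamma> = \<beta> then (\<phi> - \<psi>) \<beta> else 0)" using \<beta> by simp
    also have "\<dots> = (\<Sum>\<gamma>\<in>I2 m. (\<phi> - \<psi>) \<gamma> * unit_vec \<beta> \<gamma>)"
      by (rule sum.cong) (auto simp: unit_vec_def)
    also have "\<dots> = d * (\<Sum>\<gamma>\<in>I2 m. (\<phi> - \<psi>) \<gamma> * M j \<gamma>)"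
      unfolding d by (simp add: fun_scale_apply sum_distrib_left mult.left_commute)
    also have "\<dots> = 0" using fun_cong[OF 0, of j] j(1) by (simp add: encode_def)
    finally show ?thesis .
  qed
  moreover have "(\<phi> - \<psi>) \<beta> = 0" if "\<beta> \<notin> I2 m" for \<beta>
    using supportedD[OF pp(1) that] supportedD[OF pp(2) that] by simp
  ultimately have "(\<phi> - \<psi>) \<beta> = 0" for \<beta> by blast
  then have "\<phi> \<beta> = \<psi> \<beta>" for \<beta> by simp
  then show "\<phi> = \<psi>" by blast
qed

text \<open>Position \<open>j\<close> is outside the support exactly when all forms in
  \<open>\<Phi>\<close> vanish at column \<open>j\<close>. Small supports thus correspond to large
  sections by annihilators.\<close>

lemma card_code_support:
  fixes \<Phi> :: "(nat \<times> nat \<Rightarrow> 'a) set"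
  defines "L \<equiv> {x \<in> supported (I2 m). \<forall>\<phi>\<in>\<Phi>. (\<Sum>\<beta>\<in>I2 m. \<phi> \<beta> * x \<beta>) = 0}"
  shows "card (code_support (encode m M ` \<Phi>)) = grassmann_length TYPE('a) m - card (sections m L)"
proof -
  have "fs.subspace L"
    by (rule fs.subspaceI)
      (auto simp: L_def fun_scale_apply distrib_left sum.distrib mult.left_commute supported_def
        simp flip: sum_distrib_left)
  then have "card (sections m L) = card {j \<in> {..<grassmann_length TYPE('a) m}. M j \<in> L}" using card_columns_in by simp
  moreover have "code_support (encode m M ` \<Phi>) = {..<grassmann_length TYPE('a) m} - {j \<in> {..<grassmann_length TYPE('a) m}. M j \<in> L}"
    using column_in_supported by (auto simp: code_support_def encode_def L_def split: if_splits)
  moreover have "card ({..<grassmann_length TYPE('a) m} - {j \<in> {..<grassmann_length TYPE('a) m}. M j \<in> L}) = card {..<grassmann_length TYPE('a) m} - card {j \<in> {..<grassmann_length TYPE('a) m}. M j \<in> L}"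
    by (rule card_Diff_subset) auto
  ultimately show ?thesis by simp
qed

text \<open>Subcodes correspond to spaces of forms. The annihilator of an
  \<open>i\<close>-dimensional space of forms is small enough for \<open>opt\<close>, which bounds
  every support from below; the coordinate forms outside \<open>U\<close> attain the bound.\<close>

lemma higher_weight_eq:
  assumes U: "downset m U" "card U + i = m choose 2"
    and opt: "\<And>L :: (nat \<times> nat \<Rightarrow> 'a) set. fs.subspace L \<Longrightarrow> L \<subseteq> supported (I2 m) \<Longrightarrow>
      card L \<le> CARD('a) ^ card U \<Longrightarrow> card (sections m L) \<le> card (sections m (supported U :: (nat \<times> nat \<Rightarrow> 'a) set))"
  shows "higher_weight (grassmann_code m M) i = grassmann_length TYPE('a) m - card (sections m (supported U :: (nat \<times> nat \<Rightarrow> 'a) set))"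
  unfolding higher_weight_def
proof (rule Min_eqI)
  let ?S = "{card (code_support D) |D. fs.subspace D \<and> D \<subseteq> grassmann_code m M \<and> fs.dim D = i}"
  \<comment> \<open>The full preimage of a subcode, which has the same number of elements because
    encoding is injective.\<close>
  have enc: "\<exists>\<Phi> \<subseteq> supported (I2 m). fs.subspace \<Phi> \<and> D = encode m M ` \<Phi> \<and> card \<Phi> = CARD('a) ^ i"
    if D: "fs.subspace D" "D \<subseteq> grassmann_code m M" "fs.dim D = i" for D
  proof (intro exI conjI)
    let ?\<Phi> = "{\<phi> \<in> supported (I2 m). encode m M \<phi> \<in> D}"
    show sub: "?\<Phi> \<subseteq> supported (I2 m)" by blast
    show "fs.subspace ?\<Phi>"
    proof (rule fs.subspaceI)
      have "encode m M 0 = 0" by (auto simp: encode_def fun_eq_iff)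
      then show "0 \<in> ?\<Phi>"
        using fs.subspace_0[OF D(1)] fs.subspace_0[OF subspace_supported] by simp
    qed (simp_all add: encode_add encode_scale fs.subspace_add fs.subspace_scale D(1))
    show im: "D = encode m M ` ?\<Phi>" using D(2) unfolding grassmann_code_eq by blast
    have "card D = card ?\<Phi>"
      by (subst im) (rule card_image, rule inj_on_subset[OF inj_on_encode sub])
    moreover have "D \<subseteq> supported {..<grassmann_length TYPE('a) m}"
      using D(2) encode_in_supported unfolding grassmann_code_eq by blast
    ultimately show "card ?\<Phi> = CARD('a) ^ i"
      using card_subspace[of "{..<grassmann_length TYPE('a) m}" D] D by simp
  qed
  have "s \<le> grassmann_length TYPE('a) m" if s: "s \<in> ?S" for s
  proof -
    obtain D where D: "fs.subspace D" "D \<subseteq> grassmann_code m M" "fs.dim D = i" "s = card (code_support D)"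
      using s by blast
    obtain \<Phi> where "D = encode m M ` \<Phi>" using enc[OF D(1-3)] by blast
    then show ?thesis unfolding D(4) by (simp add: card_code_support)
  qed
  then have "?S \<subseteq> {..grassmann_length TYPE('a) m}" unfolding atMost_def by blast
  then show "finite ?S" by (rule finite_subset) simp
  show "grassmann_length TYPE('a) m - card (sections m (supported U :: (nat \<times> nat \<Rightarrow> 'a) set)) \<le> s" if s: "s \<in> ?S" for s
  proof -
    obtain D where D: "fs.subspace D" "D \<subseteq> grassmann_code m M" "fs.dim D = i" "s = card (code_support D)"
      using s by blast
    obtain \<Phi> where P: "\<Phi> \<subseteq> supported (I2 m)" "fs.subspace \<Phi>" "D = encode m M ` \<Phi>" "card \<Phi> = CARD('a) ^ i"
      using enc[OF D(1-3)] by blast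
    define L where "L = {x \<in> supported (I2 m). \<forall>\<phi>\<in>\<Phi>. (\<Sum>\<beta>\<in>I2 m. \<phi> \<beta> * x \<beta>) = 0}"
    have subL: "fs.subspace L" "L \<subseteq> supported (I2 m)"
      by (rule fs.subspaceI)
        (auto simp: L_def fun_scale_apply distrib_left sum.distrib mult.left_commute supported_def
          simp flip: sum_distrib_left)
    \<comment> \<open>Cancelling \<open>q^i = card \<Phi>\<close> leaves the bound
      \<open>q^(k - i)\<close> on the annihilator.\<close>
    have "card L * card \<Phi> \<le> CARD('a) ^ card (I2 m)"
      by (rule card_orthogonal_le[OF finite_I2 subL(2,1) P(1,2)]) (simp add: L_def)
    also have "\<dots> = CARD('a) ^ card U * CARD('a) ^ i"
      unfolding card_I2 U(2)[symmetric] by (rule power_add)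
    finally have "card L \<le> CARD('a) ^ card U" unfolding P(4) by simp
    then have "card (sections m L) \<le> card (sections m (supported U :: (nat \<times> nat \<Rightarrow> 'a) set))"
      by (rule opt[OF subL])
    then show ?thesis unfolding D(4) P(3) card_code_support L_def by simp
  qed
  show "grassmann_length TYPE('a) m - card (sections m (supported U :: (nat \<times> nat \<Rightarrow> 'a) set)) \<in> ?S"
  proof -
    have UI: "U \<subseteq> I2 m" using U(1) by (simp add: downset_def)
    \<comment> \<open>The forms supported on the complement of \<open>U\<close> have
      \<open>supported U\<close> as their common zero space.\<close>
    define V where "V = I2 m - U"
    have V: "V \<subseteq> I2 m" "finite V" unfolding V_def by auto
    have cV: "card V = i"
      unfolding V_def using U(2) card_Diff_subset[OF finite_subset[OF UI finite_I2] UI] by (simp add: card_I2)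
    have VI: "(supported V :: (nat \<times> nat \<Rightarrow> 'a) set) \<subseteq> supported (I2 m)"
      using V by (auto simp: supported_def)
    define D where "D = encode m M ` supported V"
    have D: "fs.subspace D" unfolding D_def by (rule subspace_encode_image) simp
    have "D \<subseteq> supported {..<grassmann_length TYPE('a) m}" unfolding D_def using encode_in_supported by blast
    then have "CARD('a) ^ fs.dim D = card D" using card_subspace[of "{..<grassmann_length TYPE('a) m}" D] D by simp
    also have "\<dots> = card (supported V :: (nat \<times> nat \<Rightarrow> 'a) set)"
      unfolding D_def by (rule card_image) (rule inj_on_subset[OF inj_on_encode VI])
    also have "\<dots> = CARD('a) ^ i"
      using card_subspace[OF V(2) order_refl subspace_supported, where 'a='a] dim_supported[OF V(2), where 'a='a] cV by simp
    finally have "fs.dim D = i" using card_field_gt_1[where 'a='a] by simp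
    moreover have "D \<subseteq> grassmann_code m M" unfolding D_def grassmann_code_eq using VI by blast
    moreover have "{x \<in> supported (I2 m). \<forall>\<phi>\<in>supported V. (\<Sum>\<beta>\<in>I2 m. \<phi> \<beta> * x \<beta>) = 0} = (supported U :: (nat \<times> nat \<Rightarrow> 'a) set)"
      (is "?L = _")
    proof (intro equalityI subsetI)
      fix x assume x: "x \<in> ?L"
      show "x \<in> supported U"
      proof (rule supportedI)
        fix \<beta> assume b: "\<beta> \<notin> U"
        show "x \<beta> = 0"
        proof (cases "\<beta> \<in> I2 m")
          case True
          then have "unit_vec \<beta> \<in> (supported V :: (nat \<times> nat \<Rightarrow> 'a) set)" using b by (simp add: V_def)
          then have "(\<Sum>\<gamma>\<in>I2 m. unit_vec \<beta> \<gamma> * x \<gamma>) = 0" using x by blast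
          moreover have "(\<Sum>\<gamma>\<in>I2 m. unit_vec \<beta> \<gamma> * x \<gamma>) = (\<Sum>\<gamma>\<in>I2 m. if \<gamma> = \<beta> then x \<beta> else 0)"
            by (rule sum.cong) (auto simp: unit_vec_def)
          ultimately show ?thesis using True by simp
        next
          case False
          have "x \<in> supported (I2 m)" using x by simp
          then show ?thesis using False by (rule supportedD)
        qed
      qed
    next
      fix x :: "nat \<times> nat \<Rightarrow> 'a" assume x: "x \<in> supported U"
      have "(\<Sum>\<beta>\<in>I2 m. \<phi> \<beta> * x \<beta>) = 0" if "\<phi> \<in> supported V" for \<phi>
      proof (rule sum.neutral, rule ballI)
        fix \<beta> show "\<phi> \<beta> * x \<beta> = 0"
          using supportedD[OF that, of \<beta>] supportedD[OF x, of \<beta>] by (cases "\<beta> \<in> U") (auto simp: V_def)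
      qed
      moreover have "x \<in> supported (I2 m)" using supportedD[OF x] UI by (intro supportedI) blast
      ultimately show "x \<in> ?L" by simp
    qed
    then have "card (code_support D) = grassmann_length TYPE('a) m - card (sections m (supported U :: (nat \<times> nat \<Rightarrow> 'a) set))"
      unfolding D_def card_code_support by simp
    ultimately show ?thesis using D by force
  qed
qed

end

text \<open>A subspace of codimension \<open>i\<close> has exactly \<open>q ^ card U\<close>
  elements, so \<open>opt\<close> covers every competitor. The same bound makes the set of values
  finite, as \<open>Max\<close> requires.\<close>

lemma max_section_eq:
  assumes U: "U \<subseteq> I2 m" "card U + i = m choose 2"
    and opt: "\<And>L :: (nat \<times> nat \<Rightarrow> 'a::{field,finite}) set. fs.subspace L \<Longrightarrow> L \<subseteq> supported (I2 m) \<Longrightarrow>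
      card L \<le> CARD('a) ^ card U \<Longrightarrow> card (sections m L) \<le> card (sections m (supported U :: (nat \<times> nat \<Rightarrow> 'a) set))"
  shows "max_section TYPE('a) m i = card (sections m (supported U :: (nat \<times> nat \<Rightarrow> 'a) set))"
  unfolding max_section_def card_proj_points_section
proof (rule Max_eqI)
  let ?S = "{card (sections m L) |L :: (nat \<times> nat \<Rightarrow> 'a) set. codim_subspace m i L}"
  show "s \<le> card (sections m (supported U :: (nat \<times> nat \<Rightarrow> 'a) set))" if s: "s \<in> ?S" for s
  proof -
    obtain L :: "(nat \<times> nat \<Rightarrow> 'a) set" where L: "codim_subspace m i L" "s = card (sections m L)"
      using s by blast
    then have L': "fs.subspace L" "L \<subseteq> supported (I2 m)" "fs.dim L = card U"
      using U(2) by (auto simp: codim_subspace_def plucker_space_eq_supported)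
    then show ?thesis
      using opt[OF L'(1,2)] card_subspace[OF finite_I2 L'(2,1)] L(2) by simp
  qed
  then have "?S \<subseteq> {..card (sections m (supported U :: (nat \<times> nat \<Rightarrow> 'a) set))}"
    unfolding atMost_def by blast
  then show "finite ?S" by (rule finite_subset) simp
  show "card (sections m (supported U :: (nat \<times> nat \<Rightarrow> 'a) set)) \<in> ?S"
    using codim_supported[OF U, where 'a='a] by blast
qed

theorem theorem3p3:
  fixes m :: nat
    and M :: "nat \<Rightarrow> nat \<times> nat \<Rightarrow> 'a::{field,finite}"
  assumes "m \<ge> 2"
    and "grassmann_matrix m M"
  shows "\<forall>i\<in>{1..m choose 2}.
    \<exists>(\<Lambda> :: (nat \<times> nat \<Rightarrow> 'a) set) (U :: (nat \<times> nat) set).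
      codim_subspace m i \<Lambda> \<and> U \<subseteq> I2 m \<and>
      proj_points \<Lambda> \<inter> plucker m ` grassmannian m = plucker m ` schubert_union m U \<and>
      proj_points (base_change \<Lambda>) \<inter> plucker m ` grassmannian m
        = plucker m ` schubert_union m U \<and>
      card (schubert_union m U :: (nat \<Rightarrow> 'a) set set) = max_section TYPE('a) m i \<and>
      higher_weight (grassmann_code m M) i
        = grassmann_length TYPE('a) m - card (schubert_union m U :: (nat \<Rightarrow> 'a) set set)"
proof
  fix i assume "i \<in> {1..m choose 2}"
  then have "i \<le> m choose 2" by simp
  then have i: "(m choose 2) - i + i = m choose 2" by (rule le_add_diff_inverse2)
  \<comment> \<open>The vector subspace has dimension \<open>k - i\<close>; for \<open>i = k\<close>
    this makes \<open>U\<close> and the section empty.\<close>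
  obtain U where U: "downset m U" "card U = (m choose 2) - i"
    and U_opt: "\<forall>L :: (nat \<times> nat \<Rightarrow> 'a) set. fs.subspace L \<longrightarrow> L \<subseteq> supported (I2 m) \<longrightarrow>
      card L \<le> CARD('a) ^ ((m choose 2) - i) \<longrightarrow> card (sections m L) \<le> card (sections m (supported U :: (nat \<times> nat \<Rightarrow> 'a) set))"
    using exists_optimal_downset[OF diff_le_self[of "m choose 2" i], where 'a='a] by (elim exE conjE)
  have opt: "card (sections m L) \<le> card (sections m (supported U :: (nat \<times> nat \<Rightarrow> 'a) set))"
    if "fs.subspace L" "L \<subseteq> supported (I2 m)" "card L \<le> CARD('a) ^ card U" for L :: "(nat \<times> nat \<Rightarrow> 'a) set"
    using U_opt that unfolding U(2) by simp
  have UI: "U \<subseteq> I2 m" using U(1) by (simp add: downset_def)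
  have fU: "finite U" using UI finite_I2 finite_subset by blast
  have cU: "card U + i = m choose 2" using U(2) i by simp
  have card_eq: "card (schubert_union m U :: (nat \<Rightarrow> 'a) set set)
      = card (sections m (supported U :: (nat \<times> nat \<Rightarrow> 'a) set))"
    unfolding schubert_union_eq[OF U(1)] sections_def ..
  show "\<exists>(\<Lambda> :: (nat \<times> nat \<Rightarrow> 'a) set) (U :: (nat \<times> nat) set).
      codim_subspace m i \<Lambda> \<and> U \<subseteq> I2 m \<and>
      proj_points \<Lambda> \<inter> plucker m ` grassmannian m = plucker m ` schubert_union m U \<and>
      proj_points (base_change \<Lambda>) \<inter> plucker m ` grassmannian m
        = plucker m ` schubert_union m U \<and>
      card (schubert_union m U :: (nat \<Rightarrow> 'a) set set) = max_section TYPE('a) m i \<and>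
      higher_weight (grassmann_code m M) i
        = grassmann_length TYPE('a) m - card (schubert_union m U :: (nat \<Rightarrow> 'a) set set)"
  proof (intro exI conjI)
    show "codim_subspace m i (supported U :: (nat \<times> nat \<Rightarrow> 'a) set)" by (rule codim_supported[OF UI cU])
    show "proj_points (supported U) \<inter> plucker m ` grassmannian m = plucker m ` (schubert_union m U :: (nat \<Rightarrow> 'a) set set)"
      by (rule schubert_union_section[OF U(1)])
    \<comment> \<open>The same down-set identity, now used over the algebraic closure.\<close>
    show "proj_points (base_change (supported U :: (nat \<times> nat \<Rightarrow> 'a) set)) \<inter> plucker m ` grassmannian m
        = plucker m ` schubert_union m U"
      unfolding base_change_supported[OF fU] by (rule schubert_union_section[OF U(1)])
    show "card (schubert_union m U :: (nat \<Rightarrow> 'a) set set) = max_section TYPE('a) m i"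
      unfolding card_eq using max_section_eq[OF UI cU opt] by simp
    show "higher_weight (grassmann_code m M) i
        = grassmann_length TYPE('a) m - card (schubert_union m U :: (nat \<Rightarrow> 'a) set set)"
      unfolding card_eq by (rule higher_weight_eq[OF assms(2) U(1) cU opt])
  qed (rule UI)
qed

end
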